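(* Let $G$ be an arbitrary finitely generated torsion-free nilpotent group with Mal'cev basis $(a_1,\dots,a_n)$, and let $q_1,\dots,q_n$ be the multiplication polynomials of this Mal'cev basis. Then for all $i$ we have $\nu(q_i)\le\nu(a_i)$.
   Context: A Mal'cev basis of $G$ is a tuple $(a_1,\dots,a_n)$ of elements of $G$ such that every $g\in G$ can be written uniquely as $g=a_1^{x_1}\cdots a_n^{x_n}$ with $x_i\in\mathbb Z$, and such that $G=G_1>G_2>\cdots>G_n>1$ with $G_i=\langle a_i,\dots,a_n\rangle$ is a central series. The multiplication polynomials $q_1,\dots,q_n\in\mathbb Z[x_1,\dots,x_n,y_1,\dots,y_n]$ are defined by $$a_1^{x_1}\cdots a_n^{x_n}\cdot a_1^{y_1}\cdots a_n^{y_n}=a_1^{q_1}\cdots a_n^{q_n}$$ (that the exponents are polynomial functions of $x_1,\dots,x_n,y_1,\dots,y_n$ is a theorem of Hall). Let $\Gamma_1=G$, $\Gamma_{i+1}=[\Gamma_i,G]$, and let $\tau_i=\{g\in G\mid\exists k\ge1:\ g^k\in\Gamma_i\}$ be the isolator of $\Gamma_i$. The weight $\nu(g)$ of $g\in G$ is the largest $i$ with $g\in\tau_i$. The weight of a monomial $\omega=x_1^{e_1}\cdots x_n^{e_n}y_1^{f_1}\cdots y_n^{f_n}$ is $\nu(\omega)=\sum_i(e_i+f_i)\nu(a_i)$; the weight $\nu(q)$ of a polynomial $q$ is the maximal weight of its monomials (those occurring with non-zero coefficient).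
   Formalization: The Mal'cev basis is also assumed adapted: each isolator τ_i is generated by the basis elements in it. Otherwise the claim fails, e.g. for (x, y, zt, t) in Heisenberg × Z with z=[x,y]. The multiplication polynomials may have rational coefficients. *)

theory Defs
  imports "HOL-Algebra.Generated_Groups" "HOL-Library.Poly_Mapping" "HOL.Rat"
begin

definition commutator_subgroup :: "('a, 'b) monoid_scheme \<Rightarrow> 'a set \<Rightarrow> 'a set \<Rightarrow> 'a set" where
  "commutator_subgroup G H K = generate G
     {h \<otimes>\<^bsub>G\<^esub> k \<otimes>\<^bsub>G\<^esub> inv\<^bsub>G\<^esub> h \<otimes>\<^bsub>G\<^esub> inv\<^bsub>G\<^esub> k | h k. h \<in> H \<and> k \<in> K}"

text \<open>The lower central series is indexed from 1; index 0 is a dummy value.\<close>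

fun lower_central :: "('a, 'b) monoid_scheme \<Rightarrow> nat \<Rightarrow> 'a set" where
  "lower_central G 0 = carrier G"
| "lower_central G (Suc 0) = carrier G"
| "lower_central G (Suc (Suc i)) = commutator_subgroup G (lower_central G (Suc i)) (carrier G)"

definition nilpotent_group :: "('a, 'b) monoid_scheme \<Rightarrow> bool" where
  "nilpotent_group G \<longleftrightarrow> (\<exists>c\<ge>1. lower_central G c = {\<one>\<^bsub>G\<^esub>})"

definition finitely_generated_group :: "('a, 'b) monoid_scheme \<Rightarrow> bool" where
  "finitely_generated_group G \<longleftrightarrow> (\<exists>S. finite S \<and> S \<subseteq> carrier G \<and> generate G S = carrier G)"

definition torsion_free_group :: "('a, 'b) monoid_scheme \<Rightarrow> bool" where
  "torsion_free_group G \<longleftrightarrow>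
     (\<forall>g\<in>carrier G. \<forall>k::nat. k \<ge> 1 \<longrightarrow> g [^]\<^bsub>G\<^esub> k = \<one>\<^bsub>G\<^esub> \<longrightarrow> g = \<one>\<^bsub>G\<^esub>)"

definition isolator :: "('a, 'b) monoid_scheme \<Rightarrow> 'a set \<Rightarrow> 'a set" where
  "isolator G H = {g \<in> carrier G. \<exists>k::nat. k \<ge> 1 \<and> g [^]\<^bsub>G\<^esub> k \<in> H}"

abbreviation lower_central_isolator :: "('a, 'b) monoid_scheme \<Rightarrow> nat \<Rightarrow> 'a set" where
  "lower_central_isolator G i \<equiv> isolator G (lower_central G i)"

text \<open>In a torsion-free nilpotent group the greatest index exists for every element except the
  identity, which has no meaningful weight. A member of a Mal'cev basis is never the identity.\<close>

definition weight :: "('a, 'b) monoid_scheme \<Rightarrow> 'a \<Rightarrow> nat" where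
  "weight G g = (GREATEST i. i \<ge> 1 \<and> g \<in> lower_central_isolator G i)"

text \<open>The product of the powers \<open>as ! 0 [^] xs ! 0\<close>, \<open>as ! 1 [^] xs ! 1\<close>, \<open>\<dots>\<close> in this order.\<close>

definition ordered_product :: "('a, 'b) monoid_scheme \<Rightarrow> 'a list \<Rightarrow> int list \<Rightarrow> 'a" where
  "ordered_product G as xs = foldr (\<otimes>\<^bsub>G\<^esub>) (map2 (\<lambda>a x. a [^]\<^bsub>G\<^esub> x) as xs) \<one>\<^bsub>G\<^esub>"

text \<open>Tuples are lists, so indices start at 0. With \<open>H\<close> as below, \<open>H (length as)\<close> is the trivial
  subgroup.\<close>

definition malcev_basis :: "('a, 'b) monoid_scheme \<Rightarrow> 'a list \<Rightarrow> bool" where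
  "malcev_basis G as \<longleftrightarrow>
     set as \<subseteq> carrier G \<and>
     (\<forall>g\<in>carrier G. \<exists>!xs. length xs = length as \<and> g = ordered_product G as xs) \<and>
     (let H = (\<lambda>i. generate G (set (drop i as))) in
        H 0 = carrier G \<and>
        (\<forall>i<length as. H (Suc i) \<subset> H i \<and> H i \<lhd> G \<and>
           commutator_subgroup G (H i) (carrier G) \<subseteq> H (Suc i)))"

text \<open>The basis is compatible with the isolators of the lower central series: each of them is
  generated by the basis elements it contains. This does not follow from \<open>malcev_basis\<close>. For
  example, in the direct product of the discrete Heisenberg group \<open>\<langle>x, y, z\<rangle>\<close>, where \<open>z\<close> is the
  commutator of \<open>x\<close> and \<open>y\<close>, with the infinite cyclic group \<open>\<langle>t\<rangle>\<close>, the Mal'cev basis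
  \<open>(x, y, z t, t)\<close> is not adapted. There all basis elements have weight 1, while the third
  multiplication polynomial contains the monomial \<open>x\<^sub>2 y\<^sub>1\<close> of weight 2.\<close>

definition adapted_basis :: "('a, 'b) monoid_scheme \<Rightarrow> 'a list \<Rightarrow> bool" where
  "adapted_basis G as \<longleftrightarrow>
     (\<forall>i\<ge>1. lower_central_isolator G i = generate G (set as \<inter> lower_central_isolator G i))"

datatype var = VarX nat | VarY nat

type_synonym monomial = "var \<Rightarrow>\<^sub>0 nat"

text \<open>The coefficients are rational: multiplication polynomials take integer values at integer
  points, but in general (for instance when they involve binomial coefficients) their
  coefficients are not integers.\<close>

type_synonym polynomial = "monomial \<Rightarrow>\<^sub>0 rat"

fun var_value :: "int list \<Rightarrow> int list \<Rightarrow> var \<Rightarrow> rat" where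
  "var_value xs ys (VarX i) = of_int (xs ! i)"
| "var_value xs ys (VarY i) = of_int (ys ! i)"

definition eval_polynomial :: "polynomial \<Rightarrow> (var \<Rightarrow> rat) \<Rightarrow> rat" where
  "eval_polynomial q f =
     (\<Sum>m\<in>Poly_Mapping.keys q. Poly_Mapping.lookup q m *
        (\<Prod>v\<in>Poly_Mapping.keys m. f v ^ Poly_Mapping.lookup m v))"

definition polynomial_in_vars :: "nat \<Rightarrow> polynomial \<Rightarrow> bool" where
  "polynomial_in_vars n q \<longleftrightarrow>
     (\<forall>m\<in>Poly_Mapping.keys q. Poly_Mapping.keys m \<subseteq> VarX ` {..<n} \<union> VarY ` {..<n})"

text \<open>Since a polynomial over the rationals is determined by its values at integer points, at most
  one list of polynomials satisfies this for a given Mal'cev basis.\<close>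

definition multiplication_polynomials ::
    "('a, 'b) monoid_scheme \<Rightarrow> 'a list \<Rightarrow> polynomial list \<Rightarrow> bool" where
  "multiplication_polynomials G as qs \<longleftrightarrow>
     length qs = length as \<and> (\<forall>q\<in>set qs. polynomial_in_vars (length as) q) \<and>
     (\<forall>xs ys. length xs = length as \<longrightarrow> length ys = length as \<longrightarrow>
       (\<exists>zs. length zs = length as \<and>
          (\<forall>i<length as. of_int (zs ! i) = eval_polynomial (qs ! i) (var_value xs ys)) \<and>
          ordered_product G as xs \<otimes>\<^bsub>G\<^esub> ordered_product G as ys = ordered_product G as zs))"

fun var_weight :: "('a, 'b) monoid_scheme \<Rightarrow> 'a list \<Rightarrow> var \<Rightarrow> nat" where
  "var_weight G as (VarX i) = weight G (as ! i)"
| "var_weight G as (VarY i) = weight G (as ! i)"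

definition monomial_weight :: "('a, 'b) monoid_scheme \<Rightarrow> 'a list \<Rightarrow> monomial \<Rightarrow> nat" where
  "monomial_weight G as m =
     (\<Sum>v\<in>Poly_Mapping.keys m. Poly_Mapping.lookup m v * var_weight G as v)"

text \<open>Inserting 0 only gives a value to the zero polynomial.\<close>

definition polynomial_weight :: "('a, 'b) monoid_scheme \<Rightarrow> 'a list \<Rightarrow> polynomial \<Rightarrow> nat" where
  "polynomial_weight G as q = Max (insert 0 (monomial_weight G as ` Poly_Mapping.keys q))"

end

theory Submission
  imports Defs "HOL-Algebra.Zassenhaus"
begin

text \<open>
  Put \<open>\<tau>\<^sub>k\<close> for the isolators; \<open>[\<tau>\<^sub>i, \<tau>\<^sub>j] \<subseteq> \<tau>\<^sub>i\<^sub>+\<^sub>j\<close>. Say that a function \<open>f\<close> on \<open>G\<close> has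
  degree less than \<open>n\<close> if taking differences \<open>f (x g) - f x\<close> successively in directions
  \<open>g \<in> \<tau>\<^sub>k\<close> kills it as soon as the indices \<open>k\<close> add up to at least \<open>n\<close>. The heart of the proof is
  that the \<open>i\<close>-th Mal'cev coordinate has degree at most \<open>\<nu>(a\<^sub>i)\<close>: on \<open>\<langle>a\<^sub>i, \<dots>, a\<^sub>n\<rangle>\<close> it is a
  homomorphism to the integers, and the degree is preserved when a function on \<open>\<langle>a\<^sub>j\<^sub>+\<^sub>1, \<dots>, a\<^sub>n\<rangle>\<close> is
  extended to \<open>\<langle>a\<^sub>j, \<dots>, a\<^sub>n\<rangle>\<close> by ignoring \<open>a\<^sub>j\<close>, because conjugation by \<open>a\<^sub>j\<close> moves \<open>\<tau>\<^sub>k\<close> only by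
  elements of \<open>\<tau>\<close> with index \<open>k + \<nu>(a\<^sub>j)\<close>. Hence the mixed differences of \<open>q\<^sub>i\<close> of total weight larger
  than \<open>\<nu>(a\<^sub>i)\<close> vanish at \<open>0\<close>. If \<open>q\<^sub>i\<close> had a monomial of such a weight, one of them of maximal total
  degree would contribute a non-zero value to the mixed difference of the same multi-degree,
  and no other monomial would contribute.
\<close>

section \<open>Commutators and roots\<close>

context group
begin

lemma inv_mult_cancel [simp]:
  "x \<in> carrier G \<Longrightarrow> y \<in> carrier G \<Longrightarrow> inv x \<otimes> (x \<otimes> y) = y"
  "x \<in> carrier G \<Longrightarrow> y \<in> carrier G \<Longrightarrow> x \<otimes> (inv x \<otimes> y) = y"
  by (simp_all flip: m_assoc)

definition comm :: "'a \<Rightarrow> 'a \<Rightarrow> 'a" where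
  "comm x y = x \<otimes> y \<otimes> inv x \<otimes> inv y"

lemma comm_closed [simp]: "x \<in> carrier G \<Longrightarrow> y \<in> carrier G \<Longrightarrow> comm x y \<in> carrier G"
  by (simp add: comm_def)

lemma comm_mult: "x \<in> carrier G \<Longrightarrow> y \<in> carrier G \<Longrightarrow> comm x y \<otimes> y \<otimes> x = x \<otimes> y"
  by (simp add: comm_def m_assoc)

lemma comm_eq_one_iff:
  "x \<in> carrier G \<Longrightarrow> y \<in> carrier G \<Longrightarrow> comm x y = \<one> \<longleftrightarrow> x \<otimes> y = y \<otimes> x"
  by (metis comm_closed comm_mult l_cancel_one m_assoc m_closed r_cancel_one)

lemma inv_comm_swap: "x \<in> carrier G \<Longrightarrow> y \<in> carrier G \<Longrightarrow> inv (comm x y) = comm y x"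
  by (simp add: comm_def m_assoc inv_mult_group)

lemma subgroup_centralizer:
  assumes "x \<in> carrier G"
  shows "subgroup {y \<in> carrier G. x \<otimes> y = y \<otimes> x} G"
proof (rule subgroupI)
  fix a b assume "a \<in> {y \<in> carrier G. x \<otimes> y = y \<otimes> x}"
  then have a: "a \<in> carrier G" "x \<otimes> a = a \<otimes> x" by auto
  have "inv a \<otimes> (a \<otimes> x) \<otimes> inv a = inv a \<otimes> (x \<otimes> a) \<otimes> inv a"
    unfolding a(2) ..
  moreover have "inv a \<otimes> (a \<otimes> x) \<otimes> inv a = x \<otimes> inv a" "inv a \<otimes> (x \<otimes> a) \<otimes> inv a = inv a \<otimes> x"
    using a(1) assms by (simp_all add: m_assoc)
  ultimately show "inv a \<in> {y \<in> carrier G. x \<otimes> y = y \<otimes> x}"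
    using a(1) by simp
  assume "b \<in> {y \<in> carrier G. x \<otimes> y = y \<otimes> x}"
  then show "a \<otimes> b \<in> {y \<in> carrier G. x \<otimes> y = y \<otimes> x}"
    using a assms by simp (metis m_assoc)
qed (use assms in auto)

lemma commute_comm:
  assumes "x \<in> carrier G" "y \<in> carrier G" "z \<in> carrier G"
    and "x \<otimes> y = y \<otimes> x" "x \<otimes> z = z \<otimes> x"
  shows "x \<otimes> comm y z = comm y z \<otimes> x"
proof -
  interpret C: subgroup "{y \<in> carrier G. x \<otimes> y = y \<otimes> x}" G
    by (rule subgroup_centralizer) fact
  have "y \<in> {y \<in> carrier G. x \<otimes> y = y \<otimes> x}" "z \<in> {y \<in> carrier G. x \<otimes> y = y \<otimes> x}"
    by (intro CollectI conjI assms)+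
  then have "comm y z \<in> {y \<in> carrier G. x \<otimes> y = y \<otimes> x}"
    unfolding comm_def by (intro C.m_closed C.m_inv_closed)
  then show ?thesis by blast
qed

text \<open>Applied in \<open>G / \<Gamma>\<^sub>i\<^sub>+\<^sub>j\<^sub>+\<^sub>1\<close> with \<open>x \<in> \<Gamma>\<^sub>i\<close> and \<open>y \<in> \<Gamma>\<^sub>j\<close>, in place of the three subgroups lemma.\<close>

lemma conj_comm_fixed:
  assumes [simp]: "x \<in> carrier G" "y \<in> carrier G" "g \<in> carrier G"
    and zg: "\<And>w. w \<in> carrier G \<Longrightarrow> comm x y \<otimes> w = w \<otimes> comm x y"
    and uy: "y \<otimes> comm (inv g) x = comm (inv g) x \<otimes> y"
  shows "x \<otimes> comm y g = comm y g \<otimes> x"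
proof -
  define z u where "z = comm x y" and "u = comm (inv g) x"
  have [simp]: "z \<in> carrier G" "u \<in> carrier G" by (auto simp: z_def u_def)
  have xy: "x \<otimes> y \<otimes> inv x = y \<otimes> z"
    by (simp add: z_def flip: zg) (simp add: comm_def m_assoc)
  have xg: "x \<otimes> g \<otimes> inv x = g \<otimes> u"
    by (simp add: u_def comm_def m_assoc)
  \<comment> \<open>Conjugation by \<open>x\<close> replaces \<open>y\<close> by
    \<open>y \<otimes> z\<close> and \<open>g\<close> by \<open>g \<otimes> u\<close>. The central
    \<open>z\<close> cancels against its inverse, and \<open>u\<close> passes \<open>y\<close> to
    cancel as well.\<close>
  have "x \<otimes> comm y g \<otimes> inv x
      = (x \<otimes> y \<otimes> inv x) \<otimes> (x \<otimes> g \<otimes> inv x) \<otimes> inv (x \<otimes> y \<otimes> inv x) \<otimes> inv (x \<otimes> g \<otimes> inv x)"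
    by (simp add: comm_def m_assoc inv_mult_group)
  also have "\<dots> = y \<otimes> (z \<otimes> (g \<otimes> u)) \<otimes> inv z \<otimes> inv y \<otimes> inv u \<otimes> inv g"
    by (simp add: xy xg m_assoc inv_mult_group)
  also have "\<dots> = y \<otimes> (g \<otimes> u \<otimes> z) \<otimes> inv z \<otimes> inv y \<otimes> inv u \<otimes> inv g"
    using zg[of "g \<otimes> u"] by (simp add: z_def)
  also have "\<dots> = y \<otimes> g \<otimes> (u \<otimes> inv (u \<otimes> y)) \<otimes> inv g"
    by (simp add: m_assoc inv_mult_group)
  also have "\<dots> = y \<otimes> g \<otimes> (u \<otimes> inv (y \<otimes> u)) \<otimes> inv g"
    using uy by (simp add: u_def)
  also have "\<dots> = comm y g"
    by (simp add: comm_def m_assoc inv_mult_group)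
  finally have "x \<otimes> comm y g \<otimes> inv x \<otimes> x = comm y g \<otimes> x" by simp
  then show ?thesis by (simp add: m_assoc)
qed

lemma pow_commute: "x \<in> carrier G \<Longrightarrow> x [^] (m::nat) \<otimes> x = x \<otimes> x [^] m"
  by (simp flip: nat_pow_Suc2)

text \<open>If \<open>d = [x, c]\<close> commutes with \<open>x\<close>, then \<open>[x\<^sup>m, c] = d\<^sup>m\<close>; that it does is the same claim one
  step further down the series \<open>K\<close>.\<close>

lemma pow_commute_imp_commute:
  fixes K :: "nat \<Rightarrow> 'a set"
  assumes tf: "torsion_free_group G"
    and K: "\<And>s. K s \<subseteq> carrier G" "\<And>s x c. x \<in> carrier G \<Longrightarrow> c \<in> K s \<Longrightarrow> comm x c \<in> K (Suc s)"
    and trivial: "K t \<subseteq> {\<one>}"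
    and x [simp]: "x \<in> carrier G" and "c \<in> K s" "s \<le> t" "m \<ge> 1"
    and "x [^] (m::nat) \<otimes> c = c \<otimes> x [^] m"
  shows "x \<otimes> c = c \<otimes> x"
  using \<open>s \<le> t\<close> \<open>c \<in> K s\<close> \<open>x [^] m \<otimes> c = c \<otimes> x [^] m\<close>
proof (induction arbitrary: c rule: inc_induct)
  case base
  then show ?case using trivial by auto
next
  case (step s)
  define d where "d = comm x c"
  have c [simp]: "c \<in> carrier G" using step K by blast
  have d [simp]: "d \<in> carrier G" by (simp add: d_def)
  \<comment> \<open>Since \<open>x [^] m\<close> commutes with \<open>x\<close> and with
    \<open>c\<close>, it commutes with their commutator \<open>d\<close>. As \<open>d\<close> lies
    one step deeper, the induction hypothesis applies to it.\<close>
  have "x [^] m \<otimes> d = d \<otimes> x [^] m"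
    unfolding d_def using step.prems by (intro commute_comm) (simp_all add: pow_commute)
  then have xd: "x \<otimes> d = d \<otimes> x"
    using step K(2)[OF x] by (auto simp: d_def)
  have xdk: "x \<otimes> d [^] k = d [^] k \<otimes> x" for k :: nat
  proof (induction k)
    case (Suc k)
    have "x \<otimes> d [^] Suc k = (x \<otimes> d [^] k) \<otimes> d" by (simp add: m_assoc)
    also have "\<dots> = d [^] k \<otimes> (x \<otimes> d)" by (simp add: Suc m_assoc)
    also have "\<dots> = d [^] Suc k \<otimes> x" by (simp add: xd m_assoc)
    finally show ?case .
  qed simp
  have "x [^] k \<otimes> c = d [^] k \<otimes> c \<otimes> x [^] k" for k :: nat
  proof (induction k)
    case (Suc k)
    have "x [^] Suc k \<otimes> c = x \<otimes> (x [^] k \<otimes> c)"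
      unfolding nat_pow_Suc2[OF x] by (simp add: m_assoc)
    also have "\<dots> = d [^] k \<otimes> (x \<otimes> c) \<otimes> x [^] k"
      by (simp add: Suc.IH xdk flip: m_assoc)
    also have "x \<otimes> c = d \<otimes> c \<otimes> x" using comm_mult[of x c] by (simp add: d_def)
    also have "d [^] k \<otimes> (d \<otimes> c \<otimes> x) \<otimes> x [^] k = d [^] Suc k \<otimes> c \<otimes> x [^] Suc k"
      unfolding nat_pow_Suc2[OF x] by (simp add: m_assoc)
    finally show ?case .
  qed simp
  from this[of m] have "d [^] m \<otimes> (c \<otimes> x [^] m) = c \<otimes> x [^] m"
    using step.prems by (simp add: m_assoc)
  then have "d [^] m = \<one>"
    using r_cancel_one by force
  then have "d = \<one>" using tf \<open>m \<ge> 1\<close> by (auto simp: torsion_free_group_def)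
  then show ?case by (simp add: d_def comm_eq_one_iff)
qed

end

section \<open>Quotients by normal subgroups\<close>

context normal
begin

lemma group_hom_Mod: "group_hom G (G Mod H) (\<lambda>x. H #> x)"
  by (simp add: group_hom_def group_hom_axioms_def factorgroup_is_group r_coset_hom_Mod is_group)

lemma r_coset_eq_one_iff: "x \<in> carrier G \<Longrightarrow> H #> x = \<one>\<^bsub>G Mod H\<^esub> \<longleftrightarrow> x \<in> H"
  by (metis one_FactGroup coset_join1 coset_join2 subgroup_axioms is_subgroup)

end

lemma (in group_hom) hom_comm:
  "x \<in> carrier G \<Longrightarrow> y \<in> carrier G \<Longrightarrow> h (G.comm x y) = H.comm (h x) (h y)"
  by (simp add: G.comm_def H.comm_def)

lemma (in group_hom) subgroup_vimage:
  assumes "subgroup K H"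
  shows "subgroup {w \<in> carrier G. h w \<in> K} G"
proof -
  interpret K: subgroup K H by fact
  show ?thesis by (rule G.subgroupI) (auto intro: exI[of _ \<one>])
qed

section \<open>Commutator subgroups and the lower central series\<close>

context group
begin

lemma commutator_subgroup_eq_generate_comm:
  assumes "H \<subseteq> carrier G" "K \<subseteq> carrier G"
  shows "commutator_subgroup G H K = generate G {comm h k |h k. h \<in> H \<and> k \<in> K}"
  unfolding commutator_subgroup_def comm_def ..

lemma comm_in_commutator_subgroup:
  "h \<in> H \<Longrightarrow> k \<in> K \<Longrightarrow> comm h k \<in> commutator_subgroup G H K"
  unfolding commutator_subgroup_def comm_def by (rule generate.incl) blast

text \<open>Conjugation maps the commutator of \<open>h\<close> and \<open>k\<close> to that of
  their conjugates, so the generating set is already invariant.\<close>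

lemma commutator_subgroup_normal:
  assumes H: "H \<lhd> G" and K: "K \<lhd> G"
  shows "commutator_subgroup G H K \<lhd> G"
proof -
  interpret H: normal H G by fact
  interpret K: normal K G by fact
  show ?thesis
    unfolding commutator_subgroup_eq_generate_comm[OF H.subset K.subset]
  proof (rule normal_generateI)
    fix c g assume "c \<in> {comm h k |h k. h \<in> H \<and> k \<in> K}" and g: "g \<in> carrier G"
    then obtain h k where hk: "c = comm h k" "h \<in> H" "k \<in> K" by blast
    then have "g \<otimes> c \<otimes> inv g = comm (g \<otimes> h \<otimes> inv g) (g \<otimes> k \<otimes> inv g)"
      using g by (simp add: comm_def m_assoc inv_mult_group)
    then show "g \<otimes> c \<otimes> inv g \<in> {comm h k |h k. h \<in> H \<and> k \<in> K}"
      using hk g H.inv_op_closed2 K.inv_op_closed2 by blast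
  qed auto
qed

lemma lower_central_normal: "lower_central G i \<lhd> G"
  by (induction i rule: induct_nat_012)
     (simp_all add: commutator_subgroup_normal normal_invI subgroup_self)

lemma lower_central_Suc: "i \<ge> 1 \<Longrightarrow> lower_central G (Suc i) = commutator_subgroup G (lower_central G i) (carrier G)"
  by (cases i) auto

lemma normal_comm_mem:
  assumes "H \<lhd> G" "h \<in> H" "x \<in> carrier G"
  shows "comm h x \<in> H" "comm x h \<in> H"
proof -
  interpret normal H G by fact
  have "comm h x = h \<otimes> (x \<otimes> inv h \<otimes> inv x)" "comm x h = (x \<otimes> h \<otimes> inv x) \<otimes> inv h"
    using assms by (simp_all add: comm_def m_assoc)
  then show "comm h x \<in> H" "comm x h \<in> H"
    using assms inv_op_closed2 by simp_all
qed

lemma lower_central_decseq: "lower_central G (Suc i) \<subseteq> lower_central G i"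
proof (cases "i = 0")
  case False
  interpret normal "lower_central G i" G by (rule lower_central_normal)
  have "comm h k \<in> lower_central G i" if "h \<in> lower_central G i" "k \<in> carrier G" for h k
    using that by (intro normal_comm_mem lower_central_normal)
  then show ?thesis
    using False subset
    by (subst lower_central_Suc)
       (simp_all add: commutator_subgroup_eq_generate_comm, intro generate_subgroup_incl is_subgroup, auto)
qed simp

lemma lower_central_antimono: "i \<le> j \<Longrightarrow> lower_central G j \<subseteq> lower_central G i"
  by (induction j rule: dec_induct) (use lower_central_decseq in blast)+

text \<open>In the quotient by \<open>lower_central G (Suc (i + j))\<close>, the elements commuting
  with the image of \<open>x\<close> form a subgroup. So it suffices to treat the generators
  \<open>comm y g\<close> of \<open>lower_central G (Suc j)\<close>, and these are handled by
  \<open>conj_comm_fixed\<close>.\<close>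

lemma comm_lower_central:
  assumes "i \<ge> 1" "j \<ge> 1" "x \<in> lower_central G i" "y \<in> lower_central G j"
  shows "comm x y \<in> lower_central G (i + j)"
  using assms(2,1,3,4)
proof (induction j arbitrary: i x y rule: dec_induct)
  case base
  then show ?case by (auto simp: lower_central_Suc comm_in_commutator_subgroup)
next
  case (step j)
  interpret I: normal "lower_central G i" G by (rule lower_central_normal)
  interpret J: normal "lower_central G j" G by (rule lower_central_normal)
  interpret N: normal "lower_central G (Suc (i + j))" G by (rule lower_central_normal)
  let ?Q = "G Mod lower_central G (Suc (i + j))"
  let ?p = "\<lambda>x. lower_central G (Suc (i + j)) #> x"
  interpret p: group_hom G ?Q ?p by (rule N.group_hom_Mod)
  have commute: "?p a \<otimes>\<^bsub>?Q\<^esub> ?p b = ?p b \<otimes>\<^bsub>?Q\<^esub> ?p a \<longleftrightarrow> comm a b \<in> lower_central G (Suc (i + j))"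
    if "a \<in> carrier G" "b \<in> carrier G" for a b
    using that p.hom_comm[of a b] p.H.comm_eq_one_iff[of "?p a" "?p b"] N.r_coset_eq_one_iff[of "comm a b"]
    by (simp del: mult_FactGroup one_FactGroup)
  have x: "x \<in> carrier G" using step I.subset by blast
  let ?C = "{w \<in> carrier G. ?p w \<in> {w \<in> carrier ?Q. ?p x \<otimes>\<^bsub>?Q\<^esub> w = w \<otimes>\<^bsub>?Q\<^esub> ?p x}}"
  have C: "subgroup ?C G"
    using x by (intro p.subgroup_vimage p.H.subgroup_centralizer p.hom_closed)
  have "lower_central G (Suc j) \<subseteq> ?C"
    using step.hyps subgroup.subset[OF C]
    unfolding lower_central_Suc[OF step.hyps(1)] commutator_subgroup_eq_generate_comm[OF J.subset order_refl]
  proof (intro generate_subgroup_incl C subsetI)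
    fix c assume "c \<in> {comm h k |h k. h \<in> lower_central G j \<and> k \<in> carrier G}"
    then obtain y g where c: "c = comm y g" and y: "y \<in> lower_central G j" and g: "g \<in> carrier G"
      by blast
    have y': "y \<in> carrier G" using y J.subset by blast
    \<comment> \<open>This commutator is central in the quotient, as one more commutator leads into
      \<open>lower_central G (Suc (i + j))\<close>.\<close>
    have "comm x y \<in> lower_central G (i + j)"
      using step y by blast
    then have central: "?p (comm x y) \<otimes>\<^bsub>?Q\<^esub> ?p w = ?p w \<otimes>\<^bsub>?Q\<^esub> ?p (comm x y)" if "w \<in> carrier G" for w
      using that x y' step.prems(1)
      by (subst commute) (auto simp: lower_central_Suc intro: comm_in_commutator_subgroup)
    have "comm x (inv g) \<in> lower_central G (Suc i)"
      using step.prems g by (auto simp: lower_central_Suc intro: comm_in_commutator_subgroup)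
    then have "comm (inv g) x \<in> lower_central G (Suc i)"
      using x g by (simp flip: inv_comm_swap[of x "inv g"]) 
        (meson lower_central_normal normal_imp_subgroup subgroup.m_inv_closed)
    \<comment> \<open>The induction hypothesis is used at \<open>Suc i\<close> here, which is why
      \<open>i\<close> has to vary in the induction. The index sum is again
      \<open>Suc (i + j)\<close>.\<close>
    then have "comm (comm (inv g) x) y \<in> lower_central G (Suc (i + j))"
      using step.IH[of "Suc i" _ y] y by simp
    then have u: "?p (comm (inv g) x) \<otimes>\<^bsub>?Q\<^esub> ?p y = ?p y \<otimes>\<^bsub>?Q\<^esub> ?p (comm (inv g) x)"
      using x y' g by (subst commute) auto
    have "?p x \<otimes>\<^bsub>?Q\<^esub> group.comm ?Q (?p y) (?p g) = group.comm ?Q (?p y) (?p g) \<otimes>\<^bsub>?Q\<^esub> ?p x"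
    proof (rule p.H.conj_comm_fixed)
      fix w assume "w \<in> carrier ?Q"
      then obtain w' where "w' \<in> carrier G" "w = ?p w'" by (auto simp: carrier_FactGroup)
      then show "group.comm ?Q (?p x) (?p y) \<otimes>\<^bsub>?Q\<^esub> w = w \<otimes>\<^bsub>?Q\<^esub> group.comm ?Q (?p x) (?p y)"
        using central[of w'] x y' by (simp only: p.hom_comm)
    next
      show "?p y \<otimes>\<^bsub>?Q\<^esub> group.comm ?Q (inv\<^bsub>?Q\<^esub> ?p g) (?p x) = group.comm ?Q (inv\<^bsub>?Q\<^esub> ?p g) (?p x) \<otimes>\<^bsub>?Q\<^esub> ?p y"
        using u x g by (simp only: p.hom_comm p.hom_inv inv_closed)
    qed (intro p.hom_closed x y' g)+
    then show "c \<in> ?C"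
      unfolding c using x y' g p.hom_closed[of "comm y g"] by (simp only: mem_Collect_eq p.hom_comm comm_closed simp_thms)
  qed
  then have "y \<in> ?C" using step.prems by blast
  then show ?case using commute[of x y] x by (simp del: mult_FactGroup)
qed

end

section \<open>Isolators and torsion-free quotients\<close>

context group
begin

lemma subset_isolator: "H \<subseteq> carrier G \<Longrightarrow> H \<subseteq> isolator G H"
  unfolding isolator_def by (auto intro!: exI[of _ "1::nat"])

lemma isolator_mono: "H \<subseteq> K \<Longrightarrow> isolator G H \<subseteq> isolator G K"
  unfolding isolator_def by blast

lemma isolator_root:
  assumes "x \<in> carrier G" "x [^] (k::nat) \<in> isolator G H" "k \<ge> 1"
  shows "x \<in> isolator G H"
proof -
  obtain m :: nat where "m \<ge> 1" "(x [^] k) [^] m \<in> H"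
    using assms by (auto simp: isolator_def)
  then show ?thesis
    using assms by (auto simp: isolator_def nat_pow_pow intro!: exI[of _ "k * m"])
qed

lemma conj_pow:
  assumes "x \<in> carrier G" "g \<in> carrier G"
  shows "(g \<otimes> x \<otimes> inv g) [^] (k::nat) = g \<otimes> x [^] k \<otimes> inv g"
  using assms by (induction k) (simp_all add: m_assoc)

text \<open>Conjugation commutes with powers. Closure under products is a hypothesis, because in a
  general group it can fail for roots; later it is read off from
  \<open>adapted_basis\<close>.\<close>

lemma isolator_normal:
  assumes H: "H \<lhd> G" and sub: "subgroup (isolator G H) G"
  shows "isolator G H \<lhd> G"
proof (rule normal_invI[OF sub])
  interpret normal H G by fact
  fix x h assume x: "x \<in> carrier G" and "h \<in> isolator G H"
  then obtain k :: nat where "h \<in> carrier G" "k \<ge> 1" "h [^] k \<in> H" by (auto simp: isolator_def)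
  then show "x \<otimes> h \<otimes> inv x \<in> isolator G H"
    using x inv_op_closed2[of x "h [^] k"]
    by (auto simp: isolator_def conj_pow intro!: exI[of _ k])
qed

lemma torsion_free_Mod_isolator:
  assumes "isolator G H \<lhd> G"
  shows "torsion_free_group (G Mod isolator G H)"
proof -
  interpret T: normal "isolator G H" G by fact
  show ?thesis
    unfolding torsion_free_group_def
  proof (intro ballI allI impI)
    fix w and k :: nat
    assume w: "w \<in> carrier (G Mod isolator G H)" and k: "k \<ge> 1" 
      and *: "w [^]\<^bsub>G Mod isolator G H\<^esub> k = \<one>\<^bsub>G Mod isolator G H\<^esub>"
    from w obtain x where x: "x \<in> carrier G" "w = isolator G H #> x"
      by (auto simp: carrier_FactGroup)
    with * have "x [^] k \<in> isolator G H"
      using T.r_coset_eq_one_iff[of "x [^] k"] by (simp add: T.FactGroup_pow)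
    then show "w = \<one>\<^bsub>G Mod isolator G H\<^esub>"
      using isolator_root[OF x(1) _ k, of H] x T.r_coset_eq_one_iff[of x] by simp
  qed
qed

lemma isolator_trivial: "torsion_free_group G \<Longrightarrow> isolator G {\<one>} = {\<one>}"
  by (auto simp: isolator_def torsion_free_group_def intro!: exI[of _ "1::nat"])

text \<open>Suitable powers of \<open>x\<close> and \<open>y\<close> lie in the lower central series
  itself, so they commute modulo the isolator of index \<open>i + j\<close>. The quotient is
  torsion-free and nilpotent, where elements commute as soon as some of their positive powers
  do.\<close>

lemma comm_lower_central_isolator:
  assumes nil: "nilpotent_group G"
    and sub: "subgroup (lower_central_isolator G (i + j)) G"
    and ij: "i \<ge> 1" "j \<ge> 1" and x: "x \<in> lower_central_isolator G i" and y: "y \<in> lower_central_isolator G j"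
  shows "comm x y \<in> lower_central_isolator G (i + j)"
proof -
  let ?T = "lower_central_isolator G (i + j)"
  interpret T: normal ?T G by (intro isolator_normal lower_central_normal sub)
  let ?Q = "G Mod ?T"
  let ?p = "\<lambda>x. ?T #> x"
  interpret p: group_hom G ?Q ?p by (rule T.group_hom_Mod)
  have commute: "?p a \<otimes>\<^bsub>?Q\<^esub> ?p b = ?p b \<otimes>\<^bsub>?Q\<^esub> ?p a \<longleftrightarrow> comm a b \<in> ?T"
    if "a \<in> carrier G" "b \<in> carrier G" for a b
    using that p.hom_comm[of a b] p.H.comm_eq_one_iff[of "?p a" "?p b"] T.r_coset_eq_one_iff[of "comm a b"]
    by (simp del: mult_FactGroup one_FactGroup)
  obtain c where c: "c \<ge> 1" "lower_central G c = {\<one>}"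
    using nil by (auto simp: nilpotent_group_def)
  \<comment> \<open>The index is shifted so that \<open>K 0\<close> is the whole quotient and
    \<open>K (c - 1)\<close> is trivial.\<close>
  define K where "K s = ?p ` lower_central G (Suc s)" for s
  have carrier: "lower_central G s \<subseteq> carrier G" for s
    using lower_central_normal[of s] by (simp add: normal_imp_subgroup subgroup.subset)
  have K1: "K s \<subseteq> carrier ?Q" for s
    using carrier by (auto simp: K_def carrier_FactGroup)
  have K2: "group.comm ?Q w v \<in> K (Suc s)" if wv: "w \<in> carrier ?Q" "v \<in> K s" for s w v
  proof -
    obtain a b where ab: "a \<in> carrier G" "w = ?p a" "b \<in> lower_central G (Suc s)" "v = ?p b"
      using wv(1) wv(2)[unfolded K_def] unfolding carrier_FactGroup by blast
    then have b: "b \<in> carrier G" using carrier by blast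
    have "comm a b \<in> lower_central G (Suc (Suc s))"
      using comm_lower_central[of "Suc 0" "Suc s" a b] ab by simp
    then show ?thesis
      using ab b by (auto simp: K_def simp flip: p.hom_comm)
  qed
  have K3: "K (c - 1) \<subseteq> {\<one>\<^bsub>?Q\<^esub>}"
    using c by (auto simp: K_def)
  have root: "?p a \<otimes>\<^bsub>?Q\<^esub> ?p b = ?p b \<otimes>\<^bsub>?Q\<^esub> ?p a"
    if "a \<in> carrier G" "b \<in> carrier G" "m \<ge> 1" "?p (a [^] m) \<otimes>\<^bsub>?Q\<^esub> ?p b = ?p b \<otimes>\<^bsub>?Q\<^esub> ?p (a [^] m)"
    for a b and m :: nat
  proof (rule p.H.pow_commute_imp_commute[where K = K and s = 0 and t = "c - 1" and m = m])
    show "torsion_free_group ?Q" by (intro torsion_free_Mod_isolator T.normal_axioms)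
    show "?p b \<in> K 0" using that by (simp add: K_def)
    show "?p a [^]\<^bsub>?Q\<^esub> m \<otimes>\<^bsub>?Q\<^esub> ?p b = ?p b \<otimes>\<^bsub>?Q\<^esub> ?p a [^]\<^bsub>?Q\<^esub> m"
      using that by (simp only: T.FactGroup_pow)
  qed (use K1 K2 K3 that p.hom_closed in auto)
  obtain k m :: nat where km: "x \<in> carrier G" "y \<in> carrier G" "k \<ge> 1" "m \<ge> 1"
    "x [^] k \<in> lower_central G i" "y [^] m \<in> lower_central G j"
    using x y unfolding isolator_def by blast
  have "comm (x [^] k) (y [^] m) \<in> ?T"
    by (rule subsetD[OF subset_isolator[OF carrier] comm_lower_central[OF ij km(5,6)]])
  then have "?p (x [^] k) \<otimes>\<^bsub>?Q\<^esub> ?p (y [^] m) = ?p (y [^] m) \<otimes>\<^bsub>?Q\<^esub> ?p (x [^] k)"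
    using km by (subst commute) auto
  \<comment> \<open>The exponents are removed one at a time: first that of \<open>x\<close>, then,
    with the roles exchanged, that of \<open>y\<close>.\<close>
  then have "?p x \<otimes>\<^bsub>?Q\<^esub> ?p (y [^] m) = ?p (y [^] m) \<otimes>\<^bsub>?Q\<^esub> ?p x"
    by (rule root[OF km(1) nat_pow_closed[OF km(2)] km(3)])
  then have "?p y \<otimes>\<^bsub>?Q\<^esub> ?p x = ?p x \<otimes>\<^bsub>?Q\<^esub> ?p y"
    by (rule root[OF km(2,1,4) sym])
  then have "?p x \<otimes>\<^bsub>?Q\<^esub> ?p y = ?p y \<otimes>\<^bsub>?Q\<^esub> ?p x" by (rule sym)
  then show ?thesis using km by (subst (asm) commute) auto
qed

end

text \<open>These are the properties of the isolators on which the degree argument rests. The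
  indexing is that of the lower central series; \<open>N 0\<close> is the whole group as well, by
  \<open>N_one\<close> and \<open>N_antimono\<close>.\<close>

locale central_filtration = group G for G (structure) +
  fixes N :: "nat \<Rightarrow> 'a set"
  assumes N_normal: "N i \<lhd> G"
    and N_one: "N (Suc 0) = carrier G"
    and N_antimono: "i \<le> j \<Longrightarrow> N j \<subseteq> N i"
    and comm_N: "i \<ge> 1 \<Longrightarrow> j \<ge> 1 \<Longrightarrow> x \<in> N i \<Longrightarrow> y \<in> N j \<Longrightarrow> comm x y \<in> N (i + j)"

lemma (in group) central_filtration_lower_central_isolator:
  assumes "nilpotent_group G" and "\<And>i. i \<ge> 1 \<Longrightarrow> subgroup (lower_central_isolator G i) G"
  shows "central_filtration G (lower_central_isolator G)"
proof -
  have one: "isolator G (carrier G) = carrier G"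
    using subset_isolator[of "carrier G"] by (auto simp: isolator_def)
  have "subgroup (lower_central_isolator G i) G" for i
    using assms(2)[of i] by (cases i) (auto simp: one subgroup_self)
  then have "lower_central_isolator G i \<lhd> G" for i
    by (intro isolator_normal lower_central_normal)
  then show ?thesis
    using assms one comm_lower_central_isolator isolator_mono lower_central_antimono
    by (intro central_filtration.intro central_filtration_axioms.intro is_group) simp_all
qed

section \<open>Functions of bounded degree on a filtered group\<close>

context central_filtration
begin

lemma N_subgroup: "subgroup (N i) G"
  by (rule normal_imp_subgroup[OF N_normal])

definition diff :: "'a \<Rightarrow> ('a \<Rightarrow> 'c::ab_group_add) \<Rightarrow> 'a \<Rightarrow> 'c" where
  "diff g f x = f (x \<otimes> g) - f x"

text \<open>The degree is less than \<open>n\<close> (so \<open>n = 0\<close> forces \<open>f = 0\<close> on \<open>K\<close>), and truncated subtraction accounts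
  for directions deeper than \<open>n\<close>.\<close>

fun deg_less :: "'a set \<Rightarrow> nat \<Rightarrow> ('a \<Rightarrow> 'c::ab_group_add) \<Rightarrow> bool" where
  "deg_less K 0 f \<longleftrightarrow> (\<forall>x\<in>K. f x = 0)"
| "deg_less K (Suc n) f \<longleftrightarrow> (\<forall>k. \<forall>g\<in>K \<inter> N (Suc k). deg_less K (n - k) (diff g f))"

section \<open>Functions of bounded degree on a subgroup\<close>

context
  fixes K :: "'a set"
  assumes K: "subgroup K G"
begin

interpretation K: subgroup K G by (rule K)

lemma deg_less_cong:
  assumes "\<And>x. x \<in> K \<Longrightarrow> f x = f' x"
  shows "deg_less K n f \<longleftrightarrow> deg_less K n f'"
  using assms
proof (induction n arbitrary: f f' rule: less_induct)
  case (less n)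
  show ?case
  proof (cases n)
    case (Suc m)
    have "deg_less K (m - k) (diff g f) \<longleftrightarrow> deg_less K (m - k) (diff g f')" if "g \<in> K" for k g
      using that by (intro less.IH) (auto simp: Suc diff_def less.prems)
    then show ?thesis by (auto simp: Suc)
  qed (use less.prems in simp)
qed

lemma deg_less_add: "deg_less K n f \<Longrightarrow> deg_less K n f' \<Longrightarrow> deg_less K n (\<lambda>x. f x + f' x)"
proof (induction n arbitrary: f f' rule: less_induct)
  case (less n)
  show ?case
  proof (cases n)
    case (Suc m)
    have "diff g (\<lambda>x. f x + f' x) = (\<lambda>x. diff g f x + diff g f' x)" for g
      by (auto simp: diff_def)
    then show ?thesis using less by (auto simp: Suc)
  qed (use less.prems in simp)
qed

lemma deg_less_Suc: "deg_less K n f \<Longrightarrow> deg_less K (Suc n) f"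
proof (induction n arbitrary: f rule: less_induct)
  case (less n)
  show ?case
  proof (cases n)
    case 0
    then show ?thesis using less.prems by (auto simp: diff_def)
  next
    case (Suc m)
    have "deg_less K (Suc m - k) (diff g f)" if "g \<in> K \<inter> N (Suc k)" for k g
    proof (cases "k \<le> m")
      case True
      then show ?thesis 
        using less.IH[of "m - k" "diff g f"] less.prems that by (auto simp: Suc Suc_diff_le)
    next
      \<comment> \<open>Both \<open>m - k\<close> and \<open>Suc m - k\<close> are \<open>0\<close>
        by truncation, so no induction hypothesis is involved.\<close>
      case False
      moreover have "deg_less K (m - k) (diff g f)"
        using less.prems that by (simp add: Suc)
      ultimately show ?thesis by simp
    qed
    then show ?thesis by (auto simp: Suc)
  qed
qed

lemma deg_less_mono:
  assumes "deg_less K m f" "m \<le> n"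
  shows "deg_less K n f"
  using assms(2,1) by (induction n rule: dec_induct) (blast intro: deg_less_Suc)+

lemma deg_less_const: "deg_less K (Suc 0) (\<lambda>x. c)"
  by (simp add: diff_def)

lemma deg_less_diff: "deg_less K n f \<Longrightarrow> g \<in> K \<Longrightarrow> g \<in> N k \<Longrightarrow> k \<ge> 1 \<Longrightarrow> deg_less K (n - k) (diff g f)"
  by (cases k; cases n) (auto simp: diff_def)

text \<open>The translate is \<open>f\<close> plus its difference in direction \<open>g\<close>,
  whose degree is even smaller.\<close>

lemma deg_less_translate:
  assumes "deg_less K n f" "g \<in> K"
  shows "deg_less K n (\<lambda>x. f (x \<otimes> g))"
proof -
  have "deg_less K n (diff g f)"
    using assms by (intro deg_less_mono[OF deg_less_diff[of n f g 1]]) (auto simp: N_one)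
  then have "deg_less K n (\<lambda>x. f x + diff g f x)"
    by (intro deg_less_add assms)
  then show ?thesis by (simp add: diff_def)
qed

text \<open>As \<alpha> moves elements of depth \<open>k\<close> only by factors of depth
  \<open>k + v\<close>, comparing \<open>f\<close> with its composition with \<alpha> costs at least
  as much degree as a difference in a direction of depth \<open>v\<close>. The case of interest is
  conjugation by an element of \<open>N v\<close>.\<close>

lemma deg_less_hom_diff:
  assumes \<alpha>: "\<And>x. x \<in> K \<Longrightarrow> \<alpha> x \<in> K" "\<And>x y. x \<in> K \<Longrightarrow> y \<in> K \<Longrightarrow> \<alpha> (x \<otimes> y) = \<alpha> x \<otimes> \<alpha> y"
    and shift: "\<And>k h. k \<ge> 1 \<Longrightarrow> h \<in> K \<inter> N k \<Longrightarrow> inv h \<otimes> \<alpha> h \<in> N (k + v)"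
    and "deg_less K n f"
  shows "deg_less K (n - v) (\<lambda>x. f (\<alpha> x) - f x)"
  using \<open>deg_less K n f\<close>
proof (induction n arbitrary: f rule: less_induct)
  case (less n)
  have \<alpha>_eq: "\<alpha> h = h \<otimes> (inv h \<otimes> \<alpha> h)" if "h \<in> K" for h
    using that \<alpha>(1)[OF that] by simp
  show ?case
  proof (cases "n - v")
    case 0
    \<comment> \<open>Every \<open>x\<close> has depth at least 1, so \<alpha> moves it by a factor
      of depth \<open>Suc v\<close>, which exceeds \<open>n\<close>. The corresponding difference of
      \<open>f\<close> vanishes.\<close>
    have "f (\<alpha> x) - f x = 0" if x: "x \<in> K" for x
    proof (cases n)
      case (Suc m)
      have "inv x \<otimes> \<alpha> x \<in> K \<inter> N (Suc v)"
        using shift[of 1 x] x \<alpha> by (auto simp: N_one)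
      then have "deg_less K 0 (diff (inv x \<otimes> \<alpha> x) f)"
        using less.prems 0 unfolding Suc deg_less.simps
        by (metis Suc diff_is_0_eq diff_Suc_1 Suc_leD diff_Suc_Suc diff_0_eq_0 deg_less.simps(1))
      then show ?thesis using x \<alpha>_eq[OF x] by (auto simp: diff_def)
    qed (use less.prems x \<alpha> in auto)
    then show ?thesis unfolding 0 by simp
  next
    case (Suc p)
    then obtain m where m: "n = Suc m" "p = m - v" by (cases n) auto
    have "deg_less K (p - k) (diff g (\<lambda>x. f (\<alpha> x) - f x))" if g: "g \<in> K \<inter> N (Suc k)" for g k
    proof -
      \<comment> \<open>The difference in direction \<open>g\<close> splits in two: the same kind of
        expression for \<open>?f\<close>, to which the induction hypothesis applies, and a translate
        of the difference of \<open>f\<close> in the direction \<open>?c\<close> of depth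
        \<open>Suc k + v\<close>.\<close>
      let ?f = "diff (\<alpha> g) f" and ?c = "inv g \<otimes> \<alpha> g"
      have c: "?c \<in> N (Suc k + v)" using shift[of "Suc k" g] g by simp
      then have "?c \<in> N (Suc k)" using N_antimono[of "Suc k" "Suc k + v"] by auto
      then have "g \<otimes> ?c \<in> N (Suc k)" using g N_subgroup by (blast intro: subgroup.m_closed)
      then have \<alpha>g: "\<alpha> g \<in> K \<inter> N (Suc k)" using g \<alpha> \<alpha>_eq[of g] by auto
      have "deg_less K (m - k) ?f"
        using less.prems \<alpha>g by (simp add: m)
      then have "deg_less K (m - k - v) (\<lambda>x. ?f (\<alpha> x) - ?f x)"
        by (intro less.IH) (auto simp: m)
      moreover have "deg_less K (n - (Suc k + v)) (diff ?c f)"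
        using c g \<alpha> by (intro deg_less_diff less.prems) auto
      then have "deg_less K (n - (Suc k + v)) (\<lambda>x. diff ?c f (x \<otimes> g))"
        using g by (intro deg_less_translate) auto
      ultimately have "deg_less K (p - k) (\<lambda>x. (?f (\<alpha> x) - ?f x) + diff ?c f (x \<otimes> g))"
        by (intro deg_less_add) (simp_all add: m add.commute)
      then show ?thesis
      proof (rule deg_less_cong[THEN iffD1, rotated])
        fix x assume x: "x \<in> K"
        have "x \<otimes> g \<otimes> ?c = x \<otimes> \<alpha> g"
          using x g \<alpha>(1)[of g] by (simp add: m_assoc)
        then show "?f (\<alpha> x) - ?f x + diff ?c f (x \<otimes> g) = diff g (\<lambda>x. f (\<alpha> x) - f x) x"
          using x g \<alpha> by (simp add: diff_def)
      qed
    qed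
    then show ?thesis unfolding Suc by simp
  qed
qed

lemma deg_less_diff_power:
  assumes "deg_less K n f" "g \<in> K" "g \<in> N v" "v \<ge> 1"
  shows "deg_less K (n - k * v) ((diff g ^^ k) f)"
proof (induction k)
  case (Suc k)
  show ?case
    using deg_less_diff[OF Suc assms(2-4)] by (simp add: add.commute)
qed (use assms in simp)

end

end

text \<open>Intended for \<open>K = H j\<close>, \<open>K' = H (Suc j)\<close> and
  \<open>b = as ! j\<close> of weight \<open>v\<close>. Together with \<open>b \<in> N v\<close>,
  the assumption \<open>deep\<close> says that \<open>K \<inter> N k\<close> covers \<open>K\<close>
  modulo \<open>K'\<close> for \<open>k \<le> v\<close> and is trivial there for
  \<open>k > v\<close>.\<close>

locale cyclic_extension = central_filtration G N for G (structure) and N :: "nat \<Rightarrow> 'a set" +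
  fixes K K' b v
  assumes K: "subgroup K G" and K': "K' \<lhd> G" "K' \<subseteq> K"
    and b: "b \<in> K" "b \<in> N v" "v \<ge> 1"
    and ex: "g \<in> K \<Longrightarrow> \<exists>(x::int) h. h \<in> K' \<and> g = b [^] x \<otimes> h"
    and deep: "g \<in> K \<Longrightarrow> g \<in> N k \<Longrightarrow> k > v \<Longrightarrow> g \<in> K'"
begin

sublocale K: subgroup K G by (rule K)
sublocale K': normal K' G by (rule K')

lemma b_pow: "b [^] (x::int) \<in> K" "b [^] (x::int) \<in> N v"
  using b K N_subgroup subgroup_int_pow_closed by auto

text \<open>A direction deeper than \<open>v\<close> lies in \<open>K'\<close>, and the difference
  is again an extension. Otherwise the direction is \<open>b [^] y \<otimes> u\<close>, which acts
  on the component in \<open>K'\<close> by a conjugation followed by translation by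
  \<open>u\<close>; by \<open>deg_less_hom_diff\<close> the conjugation costs enough degree.\<close>

lemma deg_less_extend:
  assumes "deg_less K' n \<phi>" and "\<And>(x::int) h. h \<in> K' \<Longrightarrow> f (b [^] x \<otimes> h) = \<phi> h"
  shows "deg_less K n f"
  using assms
proof (induction n arbitrary: f \<phi> rule: less_induct)
  case (less n)
  note [simp] = less.prems(2)
  have bc [simp]: "b [^] (x::int) \<in> carrier G" for x by (rule K.mem_carrier[OF b_pow(1)])
  show ?case
  proof (cases n)
    case 0
    then show ?thesis
      using less.prems ex by fastforce
  next
    case (Suc m)
    have "deg_less K (m - k) (diff g f)" if g: "g \<in> K" "g \<in> N (Suc k)" for g k
    proof (cases "Suc k > v")
      case True
      with g deep have gK': "g \<in> K'" by blast
      have "deg_less K' (m - k) (diff g \<phi>)"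
        using less.prems(1) g gK' by (simp add: Suc)
      then show ?thesis
        by (rule less.IH[rotated]) (use gK' in \<open>simp_all add: Suc diff_def m_assoc\<close>)
    next
      case False
      from ex[OF g(1)] obtain y :: int and u where u: "u \<in> K'" "g = b [^] y \<otimes> u" by blast
      define c where "c = inv (b [^] y)"
      have c: "c \<in> carrier G" "c \<in> N v" "inv c = b [^] y" 
        using b_pow[of y] N_subgroup[of v] by (auto simp: c_def subgroup.m_inv_closed)
      have "u = c \<otimes> g" using u by (simp add: c_def)
      \<comment> \<open>In this case \<open>Suc k \<le> v\<close>, so splitting off the power of
        \<open>b\<close> keeps the depth of the direction.\<close>
      moreover have "c \<in> N (Suc k)" using c N_antimono[of "Suc k" v] False by auto
      ultimately have uN: "u \<in> N (Suc k)" using g N_subgroup by (blast intro: subgroup.m_closed)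
      define \<alpha> where "\<alpha> h = c \<otimes> h \<otimes> inv c" for h
      have \<alpha>: "\<alpha> h \<in> K'" if "h \<in> K'" for h
        using K'.inv_op_closed2[OF c(1) that] by (simp add: \<alpha>_def)
      have *: "deg_less K' (n' - v) (\<lambda>x. \<psi> (\<alpha> x) - \<psi> x)" if "deg_less K' n' \<psi>" for n' and \<psi> :: "'a \<Rightarrow> 'c"
      proof (rule deg_less_hom_diff[OF K'.subgroup_axioms])
        fix i h assume i: "i \<ge> 1" and h: "h \<in> K' \<inter> N i"
        then have "comm (inv h) c \<in> N (i + v)"
          using b c N_subgroup[of i] by (intro comm_N) (auto simp: subgroup.m_inv_closed)
        then show "inv h \<otimes> \<alpha> h \<in> N (i + v)"
          using h c by (simp add: comm_def \<alpha>_def m_assoc)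
      next
        fix x y assume "x \<in> K'" "y \<in> K'"
        then show "\<alpha> (x \<otimes> y) = \<alpha> x \<otimes> \<alpha> y"
          using c(1) by (simp add: \<alpha>_def m_assoc)
      qed (fact \<alpha> that)+
      let ?d = "diff u \<phi>"
      have d: "deg_less K' (m - k) ?d"
        using less.prems(1) uN u by (simp add: Suc)
      have "deg_less K' (m - k) (\<lambda>x. ?d (\<alpha> x) - ?d x)"
        by (rule deg_less_mono[OF K'.subgroup_axioms *[OF d]]) simp
      \<comment> \<open>Since \<open>n = Suc m\<close> and \<open>Suc k \<le> v\<close>, the bound
        \<open>n - v\<close> is at most \<open>m - k\<close>. The summands collected next telescope
        to the difference of the extension on \<open>K'\<close>.\<close>
      moreover have "deg_less K' (m - k) (\<lambda>x. \<phi> (\<alpha> x) - \<phi> x)"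
        by (rule deg_less_mono[OF K'.subgroup_axioms *[OF less.prems(1)]]) (use False Suc in simp)
      ultimately have "deg_less K' (m - k) (\<lambda>x. (?d (\<alpha> x) - ?d x) + ?d x + (\<phi> (\<alpha> x) - \<phi> x))"
        using d by (intro deg_less_add K'.subgroup_axioms)
      then have **: "deg_less K' (m - k) (\<lambda>x. \<phi> (\<alpha> x \<otimes> u) - \<phi> x)"
        by (simp add: diff_def)
      show ?thesis
      proof (rule less.IH[OF _ **])
        fix x :: int and h assume h: "h \<in> K'"
        have "b [^] x \<otimes> h \<otimes> g = b [^] x \<otimes> b [^] y \<otimes> (\<alpha> h \<otimes> u)"
          using h u c by (simp add: \<alpha>_def c_def m_assoc)
        also have "\<dots> = b [^] (x + y) \<otimes> (\<alpha> h \<otimes> u)"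
          using b by (simp add: int_pow_mult)
        finally show "diff g f (b [^] x \<otimes> h) = \<phi> (\<alpha> h \<otimes> u) - \<phi> h"
          using h u \<alpha> by (simp add: diff_def)
      qed (simp add: Suc)
    qed
    then show ?thesis by (simp add: Suc)
  qed
qed

text \<open>Normality of \<open>K'\<close> makes \<xi> additive on \<open>K\<close>, so all its
  differences are constant. In directions deeper than \<open>v\<close> the constant is 0 by
  \<open>deep\<close>.\<close>

lemma deg_less_coordinate:
  assumes \<xi>: "\<And>x h. h \<in> K' \<Longrightarrow> \<xi> (b [^] x \<otimes> h) = (of_int x :: 'c :: ring_1)"
  shows "deg_less K (Suc v) \<xi>"
proof -
  have bc [simp]: "b [^] (x::int) \<in> carrier G" for x by (rule K.mem_carrier[OF b_pow(1)])
  have hom: "\<xi> (x \<otimes> g) - \<xi> x = \<xi> g" if x: "x \<in> K" and g: "g \<in> K" for x g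
  proof -
    from ex[OF x] obtain y :: int and h where h: "h \<in> K'" "x = b [^] y \<otimes> h" by blast
    from ex[OF g] obtain z :: int and u where u: "u \<in> K'" "g = b [^] z \<otimes> u" by blast
    have "x \<otimes> g = b [^] y \<otimes> b [^] z \<otimes> (inv (b [^] z) \<otimes> h \<otimes> b [^] z \<otimes> u)"
      using h u by (simp add: m_assoc)
    also have "b [^] y \<otimes> b [^] z = b [^] (y + z)"
      using b by (simp add: int_pow_mult)
    finally show ?thesis
      using h u K'.inv_op_closed1[of "b [^] z" h] by (simp add: \<xi>)
  qed
  have "deg_less K (v - k) (diff g \<xi>)" if g: "g \<in> K" "g \<in> N (Suc k)" for g k
  proof -
    have "deg_less K (v - k) (\<lambda>x. \<xi> g)"
    proof (cases "Suc k > v")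
      case True
      then have "g \<in> K'" using g deep by blast
      then have "\<xi> g = 0" using \<xi>[of g 0] by simp
      then show ?thesis
        using deg_less_mono[OF K, of 0 "\<lambda>x. \<xi> g"] by simp
    next
      \<comment> \<open>Here \<open>v - k\<close> is at least 1, the smallest bound that admits
        non-zero constants.\<close>
      case False
      show ?thesis
        by (rule deg_less_mono[OF K deg_less_const[OF K]]) (use False in simp)
    qed
    then show ?thesis
      by (rule deg_less_cong[OF K, THEN iffD1, rotated]) (simp add: diff_def hom g)
  qed
  then show ?thesis by simp
qed

end

section \<open>Coordinates of an adapted Mal'cev basis\<close>

context group
begin

text \<open>Both directions of conjugation are required: in an infinite group an element may
  conjugate \<open>U\<close> into a proper subgroup of \<open>U\<close>, and then its inverse does
  not preserve \<open>U\<close>.\<close>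

lemma subgroup_normalizer:
  assumes "subgroup U G"
  shows "subgroup {g \<in> carrier G. \<forall>u\<in>U. g \<otimes> u \<otimes> inv g \<in> U \<and> inv g \<otimes> u \<otimes> g \<in> U} G"
proof -
  interpret U: subgroup U G by fact
  show ?thesis
  proof (rule subgroupI)
    fix a b
    assume ab: "a \<in> {g \<in> carrier G. \<forall>u\<in>U. g \<otimes> u \<otimes> inv g \<in> U \<and> inv g \<otimes> u \<otimes> g \<in> U}"
      "b \<in> {g \<in> carrier G. \<forall>u\<in>U. g \<otimes> u \<otimes> inv g \<in> U \<and> inv g \<otimes> u \<otimes> g \<in> U}"
    then have "a \<otimes> b \<otimes> u \<otimes> inv (a \<otimes> b) \<in> U \<and> inv (a \<otimes> b) \<otimes> u \<otimes> (a \<otimes> b) \<in> U" if u: "u \<in> U" for u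
    proof -
      have "a \<otimes> (b \<otimes> u \<otimes> inv b) \<otimes> inv a \<in> U" "inv b \<otimes> (inv a \<otimes> u \<otimes> a) \<otimes> b \<in> U"
        using ab u by blast+
      then show ?thesis using ab u by (simp add: m_assoc inv_mult_group)
    qed
    with ab show "a \<otimes> b \<in> {g \<in> carrier G. \<forall>u\<in>U. g \<otimes> u \<otimes> inv g \<in> U \<and> inv g \<otimes> u \<otimes> g \<in> U}"
      by blast
  qed auto
qed

text \<open>As \<open>a\<close> normalizes \<open>U\<close>, the products of powers of
  \<open>a\<close> with elements of \<open>U\<close> form a subgroup. This splits off one basis
  element, both from the groups \<open>H j\<close> and from the layers of the isolators.\<close>

lemma generate_insert_cyclic:
  assumes U: "subgroup U G" "S \<subseteq> U" and a: "a \<in> carrier G"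
    and norm: "\<And>u. u \<in> U \<Longrightarrow> a \<otimes> u \<otimes> inv a \<in> U \<and> inv a \<otimes> u \<otimes> a \<in> U"
    and g: "g \<in> generate G (insert a S)"
  obtains x :: int and u where "u \<in> U" "g = a [^] x \<otimes> u"
proof -
  interpret U: subgroup U G by fact
  have conj: "a [^] (x::int) \<otimes> u \<otimes> inv (a [^] x) \<in> U" "inv (a [^] x) \<otimes> u \<otimes> a [^] x \<in> U" if "u \<in> U" for x u
    using subgroup_int_pow_closed[OF subgroup_normalizer[OF U(1)], of a x] a norm that by auto
  have "subgroup {a [^] (x::int) \<otimes> u | x u. u \<in> U} G"
  proof (rule subgroupI)
    fix g h assume "g \<in> {a [^] (x::int) \<otimes> u | x u. u \<in> U}" "h \<in> {a [^] (x::int) \<otimes> u | x u. u \<in> U}"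
    then obtain x y :: int and u w where gh: "g = a [^] x \<otimes> u" "u \<in> U" "h = a [^] y \<otimes> w" "w \<in> U" by blast
    have "inv g = a [^] (-x) \<otimes> (a [^] x \<otimes> inv u \<otimes> inv (a [^] x))"
      using gh a by (simp add: int_pow_neg inv_mult_group m_assoc)
    then show "inv g \<in> {a [^] (x::int) \<otimes> u | x u. u \<in> U}"
      using conj(1) gh by blast
    have "g \<otimes> h = a [^] (x + y) \<otimes> (inv (a [^] y) \<otimes> u \<otimes> a [^] y \<otimes> w)"
      using gh a by (simp add: int_pow_mult m_assoc)
    then show "g \<otimes> h \<in> {a [^] (x::int) \<otimes> u | x u. u \<in> U}"
      using conj(2) gh U.m_closed by blast
  next
    show "{a [^] (x::int) \<otimes> u | x u. u \<in> U} \<noteq> {}"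
      using U.one_closed by blast
  qed (use a in auto)
  moreover have "insert a S \<subseteq> {a [^] (x::int) \<otimes> u | x u. u \<in> U}"
  proof -
    have "a = a [^] (1::int) \<otimes> \<one>" "s = a [^] (0::int) \<otimes> s" if "s \<in> S" for s
      using a that U by auto
    then show ?thesis using U by (smt (verit) U.one_closed a insert_subset int_pow_1 mem_Collect_eq r_one subset_iff)
  qed
  ultimately show ?thesis using g generate_subgroup_incl that by blast
qed

lemma ordered_product_Cons [simp]:
  "ordered_product G (a # as) (x # xs) = a [^] x \<otimes> ordered_product G as xs"
  by (simp add: ordered_product_def)

lemma ordered_product_Nil [simp]: "ordered_product G [] xs = \<one>"
  by (simp add: ordered_product_def)

lemma ordered_product_closed:
  "set as \<subseteq> carrier G \<Longrightarrow> length xs = length as \<Longrightarrow> ordered_product G as xs \<in> carrier G"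
  by (induction as arbitrary: xs) (auto simp: length_Suc_conv)

lemma ordered_product_zeros:
  "set as \<subseteq> carrier G \<Longrightarrow> j \<le> length as \<Longrightarrow> length ys = length as - j \<Longrightarrow>
    ordered_product G as (replicate j 0 @ ys) = ordered_product G (drop j as) ys"
proof (induction j arbitrary: as)
  case (Suc j)
  then show ?case
    by (cases as) (auto simp: ordered_product_closed set_drop_subset[THEN subset_trans])
qed simp

end

section \<open>Coordinates and weights for a fixed adapted basis\<close>

locale adapted_malcev_group = group G for G (structure) +
  fixes as
  assumes torsion_free: "torsion_free_group G" and nilpotent: "nilpotent_group G"
    and malcev: "malcev_basis G as" and adapted: "adapted_basis G as"
begin

definition H where "H j = generate G (set (drop j as))"
definition wt where "wt j = weight G (as ! j)"
abbreviation \<tau> where "\<tau> \<equiv> lower_central_isolator G"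

lemma as_carrier: "set as \<subseteq> carrier G" "j < length as \<Longrightarrow> as ! j \<in> carrier G"
  using malcev by (auto simp: malcev_basis_def)

text \<open>Adaptedness exhibits each isolator as a generated subgroup, which is the remaining
  hypothesis on the filtration.\<close>

sublocale central_filtration G \<tau>
proof (rule central_filtration_lower_central_isolator[OF nilpotent])
  fix i :: nat assume "i \<ge> 1"
  then have "\<tau> i = generate G (set as \<inter> \<tau> i)"
    using adapted by (simp add: adapted_basis_def)
  moreover have "subgroup (generate G (set as \<inter> \<tau> i)) G"
    using as_carrier by (intro generate_is_subgroup) auto
  ultimately show "subgroup (\<tau> i) G" by simp
qed

lemma \<tau>_generated: "k \<ge> 1 \<Longrightarrow> \<tau> k = generate G (set as \<inter> \<tau> k)"
  using adapted by (simp add: adapted_basis_def)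

lemma H_0: "H 0 = carrier G"
  using malcev by (simp add: malcev_basis_def H_def Let_def)

lemma H_length: "H (length as) = {\<one>}"
  by (simp add: H_def generate_empty)

lemma H_normal: "j \<le> length as \<Longrightarrow> H j \<lhd> G"
  using malcev H_length one_is_normal
  by (cases "j = length as") (auto simp: malcev_basis_def Let_def simp flip: H_def)

lemma H_subgroup: "j \<le> length as \<Longrightarrow> subgroup (H j) G"
  by (intro normal_imp_subgroup H_normal)

lemma H_antimono: "i \<le> j \<Longrightarrow> H j \<subseteq> H i"
  unfolding H_def by (intro mono_generate set_drop_subset_set_drop)

lemma basis_in_H: "i \<le> j \<Longrightarrow> j < length as \<Longrightarrow> as ! j \<in> H i"
  unfolding H_def using nth_mem[of "j - i" "drop i as"] by (intro generate.incl) simp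

lemma H_cases:
  assumes "j < length as" "g \<in> H j"
  obtains x :: int and h where "h \<in> H (Suc j)" "g = as ! j [^] x \<otimes> h"
proof (rule generate_insert_cyclic[where U = "H (Suc j)" and S = "set (drop (Suc j) as)" and a = "as ! j" and g = g])
  interpret U: normal "H (Suc j)" G using assms by (intro H_normal) auto
  show "subgroup (H (Suc j)) G" by (rule U.subgroup_axioms)
  show "set (drop (Suc j) as) \<subseteq> H (Suc j)" unfolding H_def by (auto intro: generate.incl)
  show a: "as ! j \<in> carrier G" using assms as_carrier by simp
  show "as ! j \<otimes> u \<otimes> inv (as ! j) \<in> H (Suc j) \<and> inv (as ! j) \<otimes> u \<otimes> as ! j \<in> H (Suc j)" if "u \<in> H (Suc j)" for u
    using that a U.inv_op_closed1 U.inv_op_closed2 by blast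
  show "g \<in> generate G (insert (as ! j) (set (drop (Suc j) as)))"
    using assms by (simp add: H_def flip: Cons_nth_drop_Suc)
qed (use that in blast)

lemma H_ordered_product:
  assumes "j \<le> length as" "h \<in> H j"
  shows "\<exists>ys. length ys = length as - j \<and> h = ordered_product G (drop j as) ys"
  using assms
proof (induction j arbitrary: h rule: inc_induct)
  case base
  then show ?case by (simp add: H_length)
next
  case (step j)
  then obtain x :: int and u where u: "u \<in> H (Suc j)" "h = as ! j [^] x \<otimes> u"
    using H_cases by blast
  then obtain ys where "length ys = length as - Suc j" "u = ordered_product G (drop (Suc j) as) ys"
    using step by blast
  then show ?case
    using u step by (intro exI[of _ "x # ys"]) (auto simp flip: Cons_nth_drop_Suc)
qed

definition coords :: "'a \<Rightarrow> int list" where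
  "coords g = (THE xs. length xs = length as \<and> g = ordered_product G as xs)"

lemma coords_ordered_product:
  assumes "length xs = length as"
  shows "coords (ordered_product G as xs) = xs"
  unfolding coords_def
proof (rule the1_equality)
  show "\<exists>!ys. length ys = length as \<and> ordered_product G as xs = ordered_product G as ys"
    using malcev ordered_product_closed[OF as_carrier(1) assms] by (simp add: malcev_basis_def)
qed (use assms in simp)

text \<open>Elements of \<open>H (Suc j)\<close> have zeros in the positions up to \<open>j\<close>,
  and a power of \<open>as ! j\<close> on the left fills only position \<open>j\<close>. These are
  the forms in which \<open>deg_less_coordinate\<close> and \<open>deg_less_extend\<close> see the
  coordinates.\<close>

lemma coords_split:
  assumes "j < length as" "h \<in> H (Suc j)"
  shows "coords (as ! j [^] x \<otimes> h) ! j = x"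
    and "j < i \<Longrightarrow> coords (as ! j [^] x \<otimes> h) ! i = coords h ! i"
proof -
  obtain ys where ys: "length ys = length as - Suc j" "h = ordered_product G (drop (Suc j) as) ys"
    using H_ordered_product[of "Suc j" h] assms by auto
  have "h = ordered_product G as (replicate (Suc j) 0 @ ys)"
    using ys assms as_carrier by (subst ordered_product_zeros) auto
  then have h: "coords h = replicate (Suc j) 0 @ ys"
    using ys assms by (simp only:) (subst coords_ordered_product, simp_all)
  have "as ! j [^] x \<otimes> h = ordered_product G (drop j as) (x # ys)"
    using ys assms by (simp flip: Cons_nth_drop_Suc)
  also have "\<dots> = ordered_product G as (replicate j 0 @ x # ys)"
    using ys assms as_carrier by (subst ordered_product_zeros) auto
  finally have *: "coords (as ! j [^] x \<otimes> h) = replicate j 0 @ x # ys"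
    using ys assms by (simp only:) (subst coords_ordered_product, simp_all)
  show "coords (as ! j [^] x \<otimes> h) ! j = x" unfolding * by (simp add: nth_append)
  show "coords (as ! j [^] x \<otimes> h) ! i = coords h ! i" if "j < i"
    unfolding * h using that by (auto simp: nth_append nth_Cons')
qed

text \<open>Coordinate \<open>j\<close> of the power is \<open>x\<close>, but it is 0 for every
  element of \<open>H (Suc j)\<close>.\<close>

lemma basis_pow_in_H_Suc:
  assumes "j < length as" "as ! j [^] (x::int) \<in> H (Suc j)"
  shows "x = 0"
proof -
  have "\<one> \<in> H (Suc j)" using H_subgroup[of "Suc j"] assms by (simp add: subgroup.one_closed)
  then show ?thesis
    using coords_split(1)[OF assms, of 0] coords_split(1)[OF assms(1), of \<one> x] as_carrier assms by simp
qed

lemma \<tau>_eventually_trivial: "\<exists>c\<ge>1. \<forall>k\<ge>c. \<tau> k = {\<one>}"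
proof -
  obtain c where c: "c \<ge> 1" "lower_central G c = {\<one>}"
    using nilpotent by (auto simp: nilpotent_group_def)
  then have "\<tau> k \<subseteq> {\<one>}" if "k \<ge> c" for k
    using N_antimono[OF that] isolator_trivial[OF torsion_free] by simp
  then show ?thesis using c N_subgroup subgroup.one_closed by blast
qed

text \<open>The greatest index exists: a basis element is not the identity, while the isolators are
  eventually trivial.\<close>

lemma wt:
  assumes "j < length as"
  shows "wt j \<ge> 1" "as ! j \<in> \<tau> (wt j)" "k \<ge> 1 \<Longrightarrow> as ! j \<in> \<tau> k \<Longrightarrow> k \<le> wt j"
proof -
  obtain c where c: "\<forall>k\<ge>c. \<tau> k = {\<one>}" using \<tau>_eventually_trivial by blast
  have "as ! j \<noteq> \<one>"
    using basis_pow_in_H_Suc[OF assms, of 1] H_subgroup[of "Suc j"] assms as_carrier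
    by (auto simp: subgroup.one_closed)
  then have bound: "\<forall>k. k \<ge> 1 \<and> as ! j \<in> \<tau> k \<longrightarrow> k \<le> c"
    using c by (metis nle_le singletonD)
  have "1 \<ge> (1::nat) \<and> as ! j \<in> \<tau> 1" using as_carrier assms N_one by (simp del: lower_central.simps)
  from GreatestI_nat[of "\<lambda>k. k \<ge> 1 \<and> as ! j \<in> \<tau> k", OF this, of c] bound
  show "wt j \<ge> 1" "as ! j \<in> \<tau> (wt j)" by (auto simp: wt_def weight_def)
  show "k \<le> wt j" if "k \<ge> 1" "as ! j \<in> \<tau> k"
    unfolding wt_def weight_def using bound that by (intro Greatest_le_nat[where b = c]) auto
qed

end

section \<open>Compatibility of the isolators with the series \<open>H\<close>\<close>

context adapted_malcev_group
begin

text \<open>For \<open>k \<ge> 1\<close>, the subgroups generated by \<open>layer k i\<close>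
  descend from \<open>\<tau> k\<close> at \<open>i = 0\<close> to \<open>\<tau> (Suc k)\<close> at
  \<open>i = length as\<close>, losing at most one basis element at each step.\<close>

definition layer :: "nat \<Rightarrow> nat \<Rightarrow> 'a set" where
  "layer k i = {as ! m | m. i \<le> m \<and> m < length as \<and> wt m = k} \<union> \<tau> (Suc k)"

lemma layer_subset: "k \<ge> 1 \<Longrightarrow> layer k i \<subseteq> \<tau> k"
  unfolding layer_def using wt(2) N_antimono[of k "Suc k"] by auto

lemma \<tau>_carrier: "\<tau> k \<subseteq> carrier G"
  using N_subgroup subgroup.subset by blast

lemma generate_layer_subgroup: "k \<ge> 1 \<Longrightarrow> subgroup (generate G (layer k i)) G"
  using layer_subset \<tau>_carrier by (intro generate_is_subgroup) blast

lemma generate_layer_subset: "k \<ge> 1 \<Longrightarrow> generate G (layer k i) \<subseteq> \<tau> k"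
  by (intro generate_subgroup_incl layer_subset N_subgroup)

lemma \<tau>_Suc_subset_layer: "\<tau> (Suc k) \<subseteq> generate G (layer k i)"
  by (auto simp: layer_def intro: generate.incl)

lemma generate_layer_0: "k \<ge> 1 \<Longrightarrow> \<tau> k \<subseteq> generate G (layer k 0)"
proof -
  assume k: "k \<ge> 1"
  have "a \<in> layer k 0" if a: "a \<in> set as \<inter> \<tau> k" for a
  proof -
    from a obtain m where m: "m < length as" "a = as ! m" by (auto simp: in_set_conv_nth)
    then have "k \<le> wt m" using wt(3) k a by blast
    then show ?thesis
      using m wt(2)[OF m(1)] N_antimono[of "Suc k" "wt m"] by (cases "wt m = k") (auto simp: layer_def)
  qed
  then show ?thesis
    using \<tau>_generated[OF k] mono_generate[of "set as \<inter> \<tau> k" "layer k 0"] by blast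
qed

text \<open>Normality of \<open>H i\<close> makes its product with \<open>\<tau> (Suc k)\<close> a
  subgroup, and it contains the whole layer.\<close>

lemma generate_layer_decompose:
  assumes k: "k \<ge> 1" and i: "i \<le> length as" and u: "u \<in> generate G (layer k i)"
  obtains s t where "s \<in> H i" "t \<in> \<tau> (Suc k)" "u = s \<otimes> t"
proof -
  interpret Hi: normal "H i" G by (rule H_normal) fact
  have "subgroup (H i <#> \<tau> (Suc k)) G"
    by (intro mult_norm_subgroup Hi.normal_axioms N_subgroup)
  moreover have "layer k i \<subseteq> H i <#> \<tau> (Suc k)"
  proof
    fix a assume a: "a \<in> layer k i"
    then have aG: "a \<in> carrier G" using layer_subset[OF k] \<tau>_carrier by blast
    from a consider "a \<in> H i" | "a \<in> \<tau> (Suc k)"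
      unfolding layer_def using basis_in_H by auto
    then show "a \<in> H i <#> \<tau> (Suc k)"
    proof cases
      case 1
      moreover have "a = a \<otimes> \<one>" using aG by simp
      ultimately show ?thesis
        using subgroup.one_closed[OF N_subgroup] unfolding set_mult_def by blast
    next
      case 2
      moreover have "a = \<one> \<otimes> a" using aG by simp
      ultimately show ?thesis
        using Hi.one_closed unfolding set_mult_def by blast
    qed
  qed
  ultimately have "u \<in> H i <#> \<tau> (Suc k)" using u generate_subgroup_incl by blast
  then show ?thesis using that unfolding set_mult_def by blast
qed

text \<open>Commutators of elements of \<open>\<tau> k\<close> lie in \<open>\<tau> (k + k)\<close>,
  hence in \<open>\<tau> (Suc k)\<close>, which is part of the layer. So \<open>as ! i\<close>
  normalizes the group generated by the later layer.\<close>

lemma generate_layer_cases: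
  assumes k: "k \<ge> 1" and i: "i < length as" "wt i = k" and g: "g \<in> generate G (layer k i)"
  obtains x :: int and u where "u \<in> generate G (layer k (Suc i))" "g = as ! i [^] x \<otimes> u"
proof (rule generate_insert_cyclic[where U = "generate G (layer k (Suc i))" and S = "layer k (Suc i)" and a = "as ! i" and g = g])
  let ?U = "generate G (layer k (Suc i))"
  interpret U: subgroup ?U G by (rule generate_layer_subgroup[OF k])
  have *: "c \<otimes> u \<otimes> inv c \<in> ?U" if c: "c \<in> \<tau> k" and u: "u \<in> ?U" for c u
  proof -
    have "comm c u \<in> \<tau> (k + k)"
      using u k generate_layer_subset by (intro comm_N c) auto
    then have "comm c u \<in> ?U"
      using \<tau>_Suc_subset_layer N_antimono[of "Suc k" "k + k"] k by force
    then have "comm c u \<otimes> u \<in> ?U" using u by (rule U.m_closed)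
    moreover have "comm c u \<otimes> u = c \<otimes> u \<otimes> inv c"
      using U.mem_carrier[OF u] subsetD[OF \<tau>_carrier c] by (simp add: comm_def m_assoc)
    ultimately show ?thesis by simp
  qed
  have a: "as ! i \<in> \<tau> k" using i wt(2) by blast
  then show aG: "as ! i \<in> carrier G" using \<tau>_carrier by blast
  show "as ! i \<otimes> u \<otimes> inv (as ! i) \<in> ?U \<and> inv (as ! i) \<otimes> u \<otimes> as ! i \<in> ?U" if "u \<in> ?U" for u
    using *[OF a that] *[OF subgroup.m_inv_closed[OF N_subgroup a] that] aG by simp
  show "subgroup ?U G" by (rule U.subgroup_axioms)
  show "layer k (Suc i) \<subseteq> ?U" by (auto intro: generate.incl)
  have "layer k i \<subseteq> insert (as ! i) (layer k (Suc i))"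
  proof
    fix a assume "a \<in> layer k i"
    then consider m where "a = as ! m" "i = m \<or> Suc i \<le> m" "m < length as" "wt m = k" | "a \<in> \<tau> (Suc k)"
      unfolding layer_def using le_eq_less_or_eq[of i] Suc_le_eq[of i] by blast
    then show "a \<in> insert (as ! i) (layer k (Suc i))"
      by cases (auto simp: layer_def)
  qed
  then show "g \<in> generate G (insert (as ! i) (layer k (Suc i)))"
    using g mono_generate by blast
qed (use that in blast)

text \<open>Modulo \<open>\<tau> (Suc k)\<close>, an element of \<open>\<tau> k\<close> is a product of powers of the
  basis elements of weight exactly \<open>k\<close>. Those with index at most \<open>j\<close> are removed one after the other: a
  first factor \<open>as ! i\<close> with \<open>i < j\<close> would have to be compensated, modulo \<open>H (Suc i)\<close>, by an element of
  \<open>\<tau> (Suc k)\<close>, which the hypothesis for \<open>Suc k\<close> excludes.\<close>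

lemma H_Int_\<tau>_subset_step:
  assumes IH: "\<And>i. i < length as \<Longrightarrow> wt i < Suc k \<Longrightarrow> H i \<inter> \<tau> (Suc k) \<subseteq> H (Suc i)"
    and j: "j < length as" "wt j < k"
  shows "H j \<inter> \<tau> k \<subseteq> H (Suc j)"
proof -
  have k: "k \<ge> 1" using j by simp
  have sub: "H j \<inter> \<tau> k \<subseteq> generate G (layer k i)" if "i \<le> Suc j" for i
    using that
  proof (induction i)
    case 0
    then show ?case using generate_layer_0[OF k] by blast
  next
    case (Suc i)
    show ?case
    proof
      fix g assume g: "g \<in> H j \<inter> \<tau> k"
      then have gi: "g \<in> generate G (layer k i)" using Suc by auto
      show "g \<in> generate G (layer k (Suc i))"
      proof (cases "wt i = k")
        case False
        then have "layer k (Suc i) = layer k i"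
          unfolding layer_def using le_less Suc_le_eq by metis
        with gi show ?thesis by simp
      next
        case True
        \<comment> \<open>The weights differ, \<open>wt j < k = wt i\<close>, so
          \<open>i = j\<close> is impossible.\<close>
        then have ij: "i < j" using Suc.prems j by (metis le_neq_implies_less less_irrefl not_less_eq_eq)
        then have i: "i < length as" using j by simp
        interpret Hi: subgroup "H i" G using i by (intro H_subgroup) auto
        interpret HSi: subgroup "H (Suc i)" G using i by (intro H_subgroup) auto
        from generate_layer_cases[OF k i True gi] obtain y :: int and u
          where u: "u \<in> generate G (layer k (Suc i))" "g = as ! i [^] y \<otimes> u" .
        from generate_layer_decompose[OF k _ u(1)] i obtain s t
          where st: "s \<in> H (Suc i)" "t \<in> \<tau> (Suc k)" "u = s \<otimes> t" by auto
        have gH: "g \<in> H (Suc i)" using g H_antimono[of "Suc i" j] ij by auto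
        have si: "H (Suc i) \<subseteq> H i" by (rule H_antimono) simp
        let ?a = "as ! i [^] y"
        have a: "?a \<in> H i"
          using basis_in_H[of i i] i by (intro subgroup_int_pow_closed Hi.subgroup_axioms) auto
        have G: "?a \<in> carrier G" "s \<in> carrier G" "t \<in> carrier G" 
          using a st \<tau>_carrier by auto
        \<comment> \<open>This puts \<open>t\<close> into \<open>H i\<close> at depth
          \<open>Suc k\<close>, beyond the weight of \<open>as ! i\<close>. The hypothesis moves it
          to \<open>H (Suc i)\<close>, and then \<open>?a\<close> lies there too, which forces
          \<open>y = 0\<close>.\<close>
        have "t = inv s \<otimes> (inv ?a \<otimes> g)"
          using u(2) st(3) G by (simp add: m_assoc)
        then have "t \<in> H i" using a gH st si by auto
        then have tH: "t \<in> H (Suc i)" using IH[OF i] True st by auto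
        have "?a = g \<otimes> inv t \<otimes> inv s"
          using u(2) st(3) G by (simp add: m_assoc)
        then have "?a \<in> H (Suc i)" using gH tH st by simp
        then have "y = 0" using basis_pow_in_H_Suc i by blast
        then have "g = u" using u st G by simp
        then show ?thesis using u by simp
      qed
    qed
  qed
  interpret Hj: subgroup "H j" G using j by (intro H_subgroup) auto
  interpret HSj: subgroup "H (Suc j)" G using j by (intro H_subgroup) auto
  show ?thesis
  proof
    fix g assume g: "g \<in> H j \<inter> \<tau> k"
    then have "g \<in> generate G (layer k (Suc j))" using sub by blast
    from generate_layer_decompose[OF k _ this] j obtain s t
      where st: "s \<in> H (Suc j)" "t \<in> \<tau> (Suc k)" "g = s \<otimes> t" by auto
    have sH: "s \<in> H j" using st H_antimono[of j "Suc j"] by auto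
    \<comment> \<open>The same argument at \<open>j\<close> itself: \<open>t\<close> lies in
      \<open>H j\<close> and has depth \<open>Suc k\<close>.\<close>
    have "t = inv s \<otimes> g" using st(1,3) subsetD[OF \<tau>_carrier st(2)] by simp
    then have "t \<in> H j" using sH g by auto
    then have "t \<in> H (Suc j)" using IH[of j] j st by auto
    then show "g \<in> H (Suc j)" using st by simp
  qed
qed

text \<open>Descending induction on \<open>k\<close>, starting where the isolators have become
  trivial.\<close>

lemma H_Int_\<tau>_subset:
  assumes "j < length as" "wt j < k"
  shows "H j \<inter> \<tau> k \<subseteq> H (Suc j)"
proof -
  obtain c where c: "\<forall>k\<ge>c. \<tau> k = {\<one>}" using \<tau>_eventually_trivial by blast
  have large: "H j \<inter> \<tau> k \<subseteq> H (Suc j)" if "k \<ge> c" "j < length as" for j k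
    using that c H_subgroup[of "Suc j"] by (auto simp: subgroup.one_closed)
  show ?thesis
  proof (cases "k \<le> c")
    case True
    then have "\<forall>j<length as. wt j < k \<longrightarrow> H j \<inter> \<tau> k \<subseteq> H (Suc j)"
      by (induction k rule: inc_induct) (use large H_Int_\<tau>_subset_step in blast)+
    then show ?thesis using assms by blast
  qed (use large assms in auto)
qed

lemma cyclic_extension_H:
  assumes j: "j < length as"
  shows "cyclic_extension G \<tau> (H j) (H (Suc j)) (as ! j) (wt j)"
proof (intro cyclic_extension.intro cyclic_extension_axioms.intro central_filtration_axioms)
  show "H (Suc j) \<lhd> G" using j by (intro H_normal) simp
  show "subgroup (H j) G" using j by (intro H_subgroup) simp
  show "H (Suc j) \<subseteq> H j" by (intro H_antimono) simp
  show "as ! j \<in> H j" using j by (intro basis_in_H) simp_all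
  show "as ! j \<in> \<tau> (wt j)" "wt j \<ge> 1" using wt j by auto
  show "\<exists>(x::int) h. h \<in> H (Suc j) \<and> g = as ! j [^] x \<otimes> h" if "g \<in> H j" for g
    using H_cases[OF j that] by blast
  show "g \<in> H (Suc j)" if "g \<in> H j" "g \<in> \<tau> k" "k > wt j" for g k
    using H_Int_\<tau>_subset[OF j that(3)] that by blast
qed

text \<open>The bound holds on \<open>H i\<close> by \<open>deg_less_coordinate\<close>. Going down
  from \<open>H i\<close> to \<open>H 0\<close>, the exponents of the added basis elements do not
  affect coordinate \<open>i\<close>, so \<open>deg_less_extend\<close> keeps the bound.\<close>

lemma deg_less_coords:
  assumes i: "i < length as"
  shows "deg_less (carrier G) (Suc (wt i)) (\<lambda>g. of_int (coords g ! i) :: 'c :: ring_1)"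
proof -
  have "deg_less (H j) (Suc (wt i)) (\<lambda>g. of_int (coords g ! i) :: 'c)" if "j \<le> i" for j
    using that
  proof (induction j rule: inc_induct)
    case base
    interpret cyclic_extension G \<tau> "H i" "H (Suc i)" "as ! i" "wt i"
      by (rule cyclic_extension_H) fact
    show ?case by (rule deg_less_coordinate) (simp add: coords_split i)
  next
    case (step j)
    then have j: "j < length as" using i by simp
    interpret cyclic_extension G \<tau> "H j" "H (Suc j)" "as ! j" "wt j"
      by (rule cyclic_extension_H) fact
    show ?case 
      by (rule deg_less_extend[OF step.IH]) (simp add: coords_split(2)[OF j] step.hyps)
  qed
  from this[of 0] show ?thesis by (simp add: H_0)
qed

end

section \<open>Mixed differences of polynomials\<close>

definition fwd_diff :: "(int \<Rightarrow> 'a::comm_ring_1) \<Rightarrow> int \<Rightarrow> 'a" where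
  "fwd_diff p t = p (t + 1) - p t"

lemma fwd_diff_pow_sum:
  "(fwd_diff ^^ k) (\<lambda>t. \<Sum>i\<in>A. c i * p i t) = (\<lambda>t. \<Sum>i\<in>A. c i * (fwd_diff ^^ k) (p i) t)"
  by (induction k) (auto simp: fwd_diff_def sum_subtractf algebra_simps)

lemma fwd_diff_monomial:
  "fwd_diff (\<lambda>t. of_int t ^ e) = (\<lambda>t. \<Sum>i<e. of_nat (e choose i) * of_int t ^ i)"
proof
  fix t
  have "(of_int t + 1 :: 'a) ^ e = (\<Sum>i\<le>e. of_nat (e choose i) * of_int t ^ i)"
    by (simp add: binomial_ring)
  also have "\<dots> = (\<Sum>i<e. of_nat (e choose i) * of_int t ^ i) + of_int t ^ e"
    by (simp flip: lessThan_Suc_atMost)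
  finally show "fwd_diff (\<lambda>t. of_int t ^ e :: 'a) t = (\<Sum>i<e. of_nat (e choose i) * of_int t ^ i)"
    by (simp add: fwd_diff_def)
qed

text \<open>One difference replaces the monomial by terms of lower degree with leading coefficient
  \<open>e\<close>; iterating produces the factorial.\<close>

lemma fwd_diff_pow_monomial:
  "e \<le> k \<Longrightarrow> (fwd_diff ^^ k) (\<lambda>t. of_int t ^ e) = (\<lambda>t. if e = k then fact k else 0)"
proof (induction k arbitrary: e)
  case (Suc k)
  have "(fwd_diff ^^ Suc k) (\<lambda>t. of_int t ^ e :: 'a)
      = (\<lambda>t. \<Sum>i<e. of_nat (e choose i) * (if i = k then fact k else 0))"
    using Suc.prems
    by (simp only: funpow_Suc_right comp_apply fwd_diff_monomial fwd_diff_pow_sum)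
       (intro ext sum.cong refl, simp add: Suc.IH)
  also have "\<dots> = (\<lambda>t. if e = Suc k then fact (Suc k) else 0)"
    using Suc.prems by (auto simp: if_distrib sum.delta cong: if_cong)
  finally show ?case .
qed simp

section \<open>Differences in several variables\<close>

definition partial_diff :: "'v \<Rightarrow> (('v \<Rightarrow> int) \<Rightarrow> 'a::comm_ring_1) \<Rightarrow> ('v \<Rightarrow> int) \<Rightarrow> 'a" where
  "partial_diff v \<Phi> s = \<Phi> (s(v := s v + 1)) - \<Phi> s"

text \<open>The head of the list is differenced first. In the group this has to be the variable of
  the last factor of the product.\<close>

primrec mixed_diff :: "('v \<Rightarrow> nat) \<Rightarrow> 'v list \<Rightarrow> (('v \<Rightarrow> int) \<Rightarrow> 'a::comm_ring_1) \<Rightarrow> ('v \<Rightarrow> int) \<Rightarrow> 'a" where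
  "mixed_diff k [] \<Phi> = \<Phi>"
| "mixed_diff k (v # vs) \<Phi> = mixed_diff k vs ((partial_diff v ^^ k v) \<Phi>)"

lemma partial_diff_pow_sum:
  "(partial_diff v ^^ k) (\<lambda>s. \<Sum>i\<in>A. c i * \<Phi> i s) = (\<lambda>s. \<Sum>i\<in>A. c i * (partial_diff v ^^ k) (\<Phi> i) s)"
  by (induction k) (auto simp: partial_diff_def sum_subtractf algebra_simps)

lemma mixed_diff_sum:
  "mixed_diff k vs (\<lambda>s. \<Sum>i\<in>A. c i * \<Phi> i s) = (\<lambda>s. \<Sum>i\<in>A. c i * mixed_diff k vs (\<Phi> i) s)"
  by (induction vs arbitrary: \<Phi>) (simp_all add: partial_diff_pow_sum)

lemma partial_diff_pow_mult:
  assumes "\<And>s x. C (s(v := x)) = C s"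
  shows "(partial_diff v ^^ k) (\<lambda>s. C s * p (s v)) = (\<lambda>s. C s * (fwd_diff ^^ k) p (s v))"
  by (induction k) (auto simp: partial_diff_def fwd_diff_def assms algebra_simps)

text \<open>The factor \<open>C\<close> collects what comes from variables already treated, so that
  the induction over the list goes through.\<close>

lemma mixed_diff_prod:
  assumes "distinct vs" and "\<And>s v x. v \<in> set vs \<Longrightarrow> C (s(v := x)) = C s"
  shows "mixed_diff k vs (\<lambda>s. C s * (\<Prod>v\<in>set vs. p v (s v)))
    = (\<lambda>s. C s * (\<Prod>v\<in>set vs. (fwd_diff ^^ k v) (p v) (s v)))"
  using assms
proof (induction vs arbitrary: C)
  case (Cons v vs)
  let ?R = "\<lambda>s. \<Prod>u\<in>set vs. p u (s u)"
  have "?R (s(v := x)) = ?R s" for s x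
    using Cons.prems(1) by (intro prod.cong) auto
  then have *: "(partial_diff v ^^ k v) (\<lambda>s. (C s * ?R s) * p v (s v))
      = (\<lambda>s. (C s * ?R s) * (fwd_diff ^^ k v) (p v) (s v))"
    using Cons.prems(2) by (intro partial_diff_pow_mult) (simp del: fun_upd_apply)
  have "mixed_diff k (v # vs) (\<lambda>s. C s * (\<Prod>v\<in>set (v # vs). p v (s v)))
      = mixed_diff k vs (\<lambda>s. (C s * (fwd_diff ^^ k v) (p v) (s v)) * ?R s)"
    using Cons.prems(1) * by (simp add: mult_ac)
  also have "\<dots> = (\<lambda>s. (C s * (fwd_diff ^^ k v) (p v) (s v)) * (\<Prod>v\<in>set vs. (fwd_diff ^^ k v) (p v) (s v)))"
    using Cons.prems by (intro Cons.IH) auto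
  finally show ?case using Cons.prems(1) by (simp add: mult_ac)
qed simp

lemma weight_le_if_mixed_diff_eq_0:
  fixes q :: polynomial and \<omega> :: "var \<Rightarrow> nat"
  assumes vs: "distinct vs" "\<And>m. m \<in> Poly_Mapping.keys q \<Longrightarrow> Poly_Mapping.keys m \<subseteq> set vs"
    and zero: "\<And>k. w < (\<Sum>v\<in>set vs. k v * \<omega> v) \<Longrightarrow>
      mixed_diff k vs (\<lambda>s. eval_polynomial q (\<lambda>v. of_int (s v))) (\<lambda>_. 0) = 0"
    and m: "m \<in> Poly_Mapping.keys q"
  shows "(\<Sum>v\<in>set vs. Poly_Mapping.lookup m v * \<omega> v) \<le> w"
proof (rule ccontr)
  let ?wt = "\<lambda>m. \<Sum>v\<in>set vs. Poly_Mapping.lookup m v * \<omega> v"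
  let ?deg = "\<lambda>m. \<Sum>v\<in>set vs. Poly_Mapping.lookup m v"
  define A where "A = {m \<in> Poly_Mapping.keys q. w < ?wt m}"
  assume "\<not> ?wt m \<le> w"
  then have "m \<in> A" using m by (simp add: A_def)
  then have "Max (?deg ` A) \<in> ?deg ` A" by (intro Max_in) (auto simp: A_def)
  then obtain M where "M \<in> A" and "Max (?deg ` A) = ?deg M" by blast
  moreover have "finite A" by (simp add: A_def)
  ultimately have M: "M \<in> A" "\<And>m. m \<in> A \<Longrightarrow> ?deg m \<le> ?deg M"
    using Max_ge[of "?deg ` A"] by (auto simp: image_iff)
  \<comment> \<open>The products are extended to all variables, and the factor 1 is the initial
    \<open>C\<close> of \<open>mixed_diff_prod\<close>.\<close>
  have eval: "eval_polynomial q (\<lambda>v. of_int (s v))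
      = (\<Sum>m\<in>Poly_Mapping.keys q. Poly_Mapping.lookup q m * (1 * (\<Prod>v\<in>set vs. of_int (s v) ^ Poly_Mapping.lookup m v)))" for s
    unfolding eval_polynomial_def
    using vs(2) by (intro sum.cong refl arg_cong2[of _ _ _ _ "(*)"])
      (simp, intro prod.mono_neutral_left, auto simp: in_keys_iff)
  define \<delta> where "\<delta> m = (\<Prod>v\<in>set vs. (fwd_diff ^^ Poly_Mapping.lookup M v) (\<lambda>t. of_int t ^ Poly_Mapping.lookup m v) 0 :: rat)" for m
  have "mixed_diff (Poly_Mapping.lookup M) vs (\<lambda>s. eval_polynomial q (\<lambda>v. of_int (s v))) (\<lambda>_. 0)
      = (\<Sum>m\<in>Poly_Mapping.keys q. Poly_Mapping.lookup q m * \<delta> m)"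
    unfolding eval mixed_diff_sum \<delta>_def
    by (subst mixed_diff_prod[where C = "\<lambda>_. 1" and p = "\<lambda>v t. of_int t ^ Poly_Mapping.lookup _ v"]) (use vs(1) in simp_all)
  also have "\<dots> = (\<Sum>m\<in>Poly_Mapping.keys q. if m = M then Poly_Mapping.lookup q M * \<delta> M else 0)"
  proof (intro sum.cong refl)
    fix m assume m: "m \<in> Poly_Mapping.keys q"
    have "\<delta> m = 0" if "m \<noteq> M"
    proof -
      have "\<exists>v\<in>set vs. Poly_Mapping.lookup m v < Poly_Mapping.lookup M v"
      proof (rule ccontr)
        assume "\<not> ?thesis"
        then have le: "\<And>v. v \<in> set vs \<Longrightarrow> Poly_Mapping.lookup M v \<le> Poly_Mapping.lookup m v" by force
        \<comment> \<open>A monomial whose exponents dominate those of \<open>M\<close> is too heavy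
          as well. Maximality of the degree of \<open>M\<close> then makes all exponents
          agree.\<close>
        then have "?wt M \<le> ?wt m" by (intro sum_mono mult_right_mono) auto
        then have "m \<in> A" using M(1) m by (simp add: A_def)
        then have "?deg m \<le> ?deg M" by (rule M(2))
        moreover have "?deg M \<le> ?deg m" by (intro sum_mono le)
        ultimately have "?deg m = ?deg M" by simp
        then have "Poly_Mapping.lookup M v = Poly_Mapping.lookup m v" if "v \<in> set vs" for v
          using sum_mono_inv[of "Poly_Mapping.lookup M" "set vs" "Poly_Mapping.lookup m"] le that by auto
        moreover have "Poly_Mapping.lookup M v = Poly_Mapping.lookup m v" if "v \<notin> set vs" for v
        proof -
          have "v \<notin> Poly_Mapping.keys M" "v \<notin> Poly_Mapping.keys m"
            using vs(2)[OF m] vs(2)[of M] M(1) that by (auto simp: A_def)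
          then show ?thesis by (simp add: in_keys_iff)
        qed
        ultimately have "m = M" by (intro poly_mapping_eqI) metis
        then show False using \<open>m \<noteq> M\<close> by simp
      qed
      then show ?thesis
        unfolding \<delta>_def by (auto simp: fwd_diff_pow_monomial intro!: prod_zero bexI)
    qed
    then show "Poly_Mapping.lookup q m * \<delta> m = (if m = M then Poly_Mapping.lookup q M * \<delta> M else 0)"
      by simp
  qed
  also have "\<dots> = Poly_Mapping.lookup q M * \<delta> M"
    using M(1) by (simp add: A_def)
  also have "\<delta> M = (\<Prod>v\<in>set vs. fact (Poly_Mapping.lookup M v))"
    unfolding \<delta>_def by (simp add: fwd_diff_pow_monomial)
  finally have "mixed_diff (Poly_Mapping.lookup M) vs (\<lambda>s. eval_polynomial q (\<lambda>v. of_int (s v))) (\<lambda>_. 0) \<noteq> 0"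
    using M(1) by (auto simp: A_def in_keys_iff)
  then show False using zero M(1) by (simp add: A_def)
qed

section \<open>Multiplication polynomials as functions on the group\<close>

lemma (in group) ordered_product_append:
  "set us \<subseteq> carrier G \<Longrightarrow> set vs \<subseteq> carrier G \<Longrightarrow> length xs = length us \<Longrightarrow> length ys = length vs \<Longrightarrow>
    ordered_product G (us @ vs) (xs @ ys) = ordered_product G us xs \<otimes> ordered_product G vs ys"
  by (induction us arbitrary: xs) (auto simp: length_Suc_conv ordered_product_closed m_assoc)

text \<open>Increasing the variable of the last factor multiplies the product on the right by a
  group element, so a partial difference becomes a difference on the group. Afterwards that variable
  is set to 0 and the previous factor becomes the last one; hence the reversed list and the
  condition on \<Phi> only where the other variables vanish.\<close>

lemma (in central_filtration) mixed_diff_eq_0: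
  fixes \<gamma> :: "'v \<Rightarrow> 'a" and f :: "'a \<Rightarrow> 'c::comm_ring_1"
  assumes "distinct vs" and \<gamma>: "\<And>v. v \<in> set vs \<Longrightarrow> \<gamma> v \<in> N (\<omega> v) \<and> \<omega> v \<ge> 1"
    and "deg_less (carrier G) n f"
    and "\<And>s. (\<And>v. v \<notin> set vs \<Longrightarrow> s v = 0) \<Longrightarrow> \<Phi> s = f (ordered_product G (map \<gamma> (rev vs)) (map s (rev vs)))"
    and "n \<le> (\<Sum>v\<in>set vs. k v * \<omega> v)"
  shows "mixed_diff k vs \<Phi> (\<lambda>_. 0) = 0"
  using assms
proof (induction vs arbitrary: n f \<Phi>)
  \<comment> \<open>The empty sum forces \<open>n = 0\<close>, so \<open>f\<close> vanishes on the
    whole group.\<close>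
  case Nil
  then show ?case by simp
next
  case (Cons v vs)
  let ?P = "\<lambda>vs s. ordered_product G (map \<gamma> (rev vs)) (map s (rev vs))"
  have N_carrier: "N i \<subseteq> carrier G" for i using N_subgroup subgroup.subset by blast
  have \<gamma>_carrier: "\<gamma> u \<in> carrier G" if "u \<in> set (v # vs)" for u
    using Cons.prems(2)[OF that] N_carrier by blast
  then have P_carrier: "?P vs s \<in> carrier G" for s :: "'v \<Rightarrow> int"
    by (intro ordered_product_closed) auto
  have P_Cons: "?P (v # vs) s = ?P vs s \<otimes> \<gamma> v [^] s v" for s :: "'v \<Rightarrow> int"
    using \<gamma>_carrier by (simp add: ordered_product_append image_subset_iff)
  have step: "(partial_diff v ^^ j) \<Phi> s = (diff (\<gamma> v) ^^ j) f (?P (v # vs) s)"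
    if "\<And>u. u \<notin> set (v # vs) \<Longrightarrow> s u = 0" for s j
    using that
  proof (induction j arbitrary: s)
    case 0
    then show ?case using Cons.prems(4)[of s] by simp
  next
    case (Suc j)
    let ?s = "s(v := s v + 1)"
    have "?P vs ?s = ?P vs s"
      using Cons.prems(1) by (intro arg_cong2[of _ _ _ _ "ordered_product G"]) auto
    then have "?P (v # vs) ?s = ?P (v # vs) s \<otimes> \<gamma> v"
      using \<gamma>_carrier P_carrier by (simp only: P_Cons) (simp add: int_pow_mult m_assoc)
    moreover have "(partial_diff v ^^ j) \<Phi> ?s = (diff (\<gamma> v) ^^ j) f (?P (v # vs) ?s)"
      using Suc.prems by (intro Suc.IH) auto
    ultimately show ?case
      unfolding funpow.simps(2) comp_apply partial_diff_def[of v "(partial_diff v ^^ j) \<Phi>"]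
        diff_def[of "\<gamma> v" "(diff (\<gamma> v) ^^ j) f"]
      using Suc.IH[of s] Suc.prems by simp
  qed
  have "mixed_diff k vs ((partial_diff v ^^ k v) \<Phi>) (\<lambda>_. 0) = 0"
  proof (rule Cons.IH)
    show "deg_less (carrier G) (n - k v * \<omega> v) ((diff (\<gamma> v) ^^ k v) f)"
      using Cons.prems \<gamma>_carrier by (intro deg_less_diff_power subgroup_self) auto
    show "n - k v * \<omega> v \<le> (\<Sum>v\<in>set vs. k v * \<omega> v)"
      using Cons.prems by simp
    fix s :: "'v \<Rightarrow> int" assume s: "\<And>u. u \<notin> set vs \<Longrightarrow> s u = 0"
    then have "s v = 0" using Cons.prems(1) by simp
    then have "?P (v # vs) s = ?P vs s" using P_carrier by (simp only: P_Cons) simp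
    then show "(partial_diff v ^^ k v) \<Phi> s = (diff (\<gamma> v) ^^ k v) f (?P vs s)"
      using step[of s "k v"] s by simp
  qed (use Cons.prems in auto)
  then show ?case by simp
qed

lemma eval_polynomial_cong:
  assumes "\<And>m v. m \<in> Poly_Mapping.keys q \<Longrightarrow> v \<in> Poly_Mapping.keys m \<Longrightarrow> f v = g v"
  shows "eval_polynomial q f = eval_polynomial q g"
  unfolding eval_polynomial_def using assms by (intro sum.cong prod.cong arg_cong2[of _ _ _ _ "(*)"]) auto

text \<open>At integer points \<open>qs ! i\<close> is coordinate \<open>i\<close> of a product of
  powers of basis elements with one factor for each variable. So \<open>deg_less_coords\<close>
  makes its heavy mixed differences vanish.\<close>

lemma (in adapted_malcev_group) multiplication_polynomial_weight:
  assumes qs: "multiplication_polynomials G as qs" and i: "i < length as"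
  shows "polynomial_weight G as (qs ! i) \<le> wt i"
proof -
  let ?n = "length as"
  define X Y where "X = map VarX [0..<?n]" and "Y = map VarY [0..<?n]"
  \<comment> \<open>Reversed, because \<open>mixed_diff_eq_0\<close> takes the variables from the
    last factor to the first.\<close>
  define vs where "vs = rev (X @ Y)"
  define \<gamma> where "\<gamma> v = (case v of VarX j \<Rightarrow> as ! j | VarY j \<Rightarrow> as ! j)" for v
  have distinct: "distinct vs"
    by (auto simp: vs_def X_def Y_def distinct_map inj_on_def)
  have set_vs: "set vs = VarX ` {..<?n} \<union> VarY ` {..<?n}"
    by (auto simp: vs_def X_def Y_def)
  have vars: "Poly_Mapping.keys m \<subseteq> set vs" if "m \<in> Poly_Mapping.keys (qs ! i)" for m
    using qs nth_mem[of i qs] i that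
    unfolding multiplication_polynomials_def polynomial_in_vars_def set_vs by metis
  have basis: "map \<gamma> X = as" "map \<gamma> Y = as"
    by (auto simp: X_def Y_def \<gamma>_def intro!: nth_equalityI)
  have "(\<Sum>v\<in>set vs. Poly_Mapping.lookup m v * var_weight G as v) \<le> wt i"
    if "m \<in> Poly_Mapping.keys (qs ! i)" for m
  proof (rule weight_le_if_mixed_diff_eq_0[OF distinct vars _ that])
    fix k assume k: "wt i < (\<Sum>v\<in>set vs. k v * var_weight G as v)"
    show "mixed_diff k vs (\<lambda>s. eval_polynomial (qs ! i) (\<lambda>v. of_int (s v))) (\<lambda>_. 0) = 0"
    proof (rule mixed_diff_eq_0[OF distinct _ deg_less_coords[OF i]])
      show "\<gamma> v \<in> \<tau> (var_weight G as v) \<and> 1 \<le> var_weight G as v" if "v \<in> set vs" for v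
        using that wt by (auto simp: set_vs \<gamma>_def wt_def simp del: One_nat_def)
      show "Suc (wt i) \<le> (\<Sum>v\<in>set vs. k v * var_weight G as v)" using k by simp
      fix s :: "var \<Rightarrow> int"
      let ?xs = "map s X" and ?ys = "map s Y"
      have len: "length ?xs = ?n" "length ?ys = ?n" by (simp_all add: X_def Y_def)
      then obtain zs where zs: "length zs = ?n"
        "\<And>i. i < ?n \<Longrightarrow> of_int (zs ! i) = eval_polynomial (qs ! i) (var_value ?xs ?ys)"
        "ordered_product G as ?xs \<otimes> ordered_product G as ?ys = ordered_product G as zs"
        using qs unfolding multiplication_polynomials_def by blast
      have "eval_polynomial (qs ! i) (\<lambda>v. of_int (s v)) = eval_polynomial (qs ! i) (var_value ?xs ?ys)"
      proof (rule eval_polynomial_cong)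
        fix m v assume "m \<in> Poly_Mapping.keys (qs ! i)" "v \<in> Poly_Mapping.keys m"
        then have "v \<in> set vs" using vars by blast
        then show "of_int (s v) = var_value ?xs ?ys v"
          by (auto simp: set_vs X_def Y_def)
      qed
      also have "\<dots> = of_int (coords (ordered_product G as ?xs \<otimes> ordered_product G as ?ys) ! i)"
        using zs i by (simp add: coords_ordered_product)
      also have "ordered_product G as ?xs \<otimes> ordered_product G as ?ys
          = ordered_product G (map \<gamma> (rev vs)) (map s (rev vs))"
        using len as_carrier(1) by (simp add: vs_def basis ordered_product_append)
      finally show "eval_polynomial (qs ! i) (\<lambda>v. of_int (s v))
          = of_int (coords (ordered_product G (map \<gamma> (rev vs)) (map s (rev vs))) ! i)" .
    qed
  qed
  moreover have "monomial_weight G as m = (\<Sum>v\<in>set vs. Poly_Mapping.lookup m v * var_weight G as v)"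
    if "m \<in> Poly_Mapping.keys (qs ! i)" for m
    unfolding monomial_weight_def using vars[OF that]
    by (intro sum.mono_neutral_left) (auto simp: in_keys_iff)
  ultimately show ?thesis by (auto simp: polynomial_weight_def)
qed

theorem lemma5p1:
  fixes G :: "('a, 'b) monoid_scheme" and as :: "'a list" and qs :: "polynomial list"
  assumes "group G"
    and "finitely_generated_group G"
    and "torsion_free_group G"
    and "nilpotent_group G"
    and "malcev_basis G as"
    and "adapted_basis G as"
    and "multiplication_polynomials G as qs"
  shows "\<forall>i<length as. polynomial_weight G as (qs ! i) \<le> weight G (as ! i)"
proof -
  interpret adapted_malcev_group G as
    using assms by (intro adapted_malcev_group.intro adapted_malcev_group_axioms.intro)
  show ?thesis
    using multiplication_polynomial_weight[OF assms(7)] by (simp add: wt_def)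
qed

end
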